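(* Let $r \in (0,1)$. Let $X_1, X_2, \dots$ be i.i.d. random vectors in $\mathbb{R}^d$ with a spherically symmetric unimodal density with compact support, and let $Z_n = \frac{X_1 + \cdots + X_n}{\sqrt{n}}$. Then $$\lim_{n \to \infty} h_r(Z_n) = h_r(Z),$$ where $Z$ is a Gaussian random vector with mean $0$ and the same covariance matrix as $X_1$.
   Context: For a random vector $X$ in $\mathbb{R}^d$ with density $f$ with respect to Lebesgue measure and $r \in (0,1)\cup(1,\infty)$, the $r$-R\'enyi entropy is $h_r(X) = \frac{1}{1-r}\log \int_{\mathbb{R}^d} f(x)^r\,dx$. A function $f:\mathbb{R}^d\to\mathbb{R}$ is unimodal if the super-level sets $\{x\in\mathbb{R}^d : f(x)>t\}$ are convex for all $t\in\mathbb{R}$. It is spherically symmetric if $f(Tx)=f(x)$ for every orthogonal map $T$ and every $x\in\mathbb{R}^d$. Standing assumption of the section: $\{X_n\}_{n\in\mathbb{N}}$ is a sequence of i.i.d. centered random vectors with finite covariance matrix. *)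

theory Defs
  imports "HOL-Probability.Probability"
begin

definition ln_ereal :: "ennreal \<Rightarrow> ereal" where
  "ln_ereal x =
     (if x = 0 then - \<infinity> else if x = \<top> then \<infinity> else ereal (ln (enn2real x)))"

text \<open>
  The density of \<open>X\<close> is the Radon-Nikodym derivative of its law with respect to Lebesgue measure;
  \<open>renyi_entropy_distributed\<close> below shows that every other version of the density gives the same
  value. The entropy is extended-real valued, because the integral may diverge. If \<open>X\<close> has no
  density, then \<^const>\<open>RN_deriv\<close> is the zero function by convention, and the value is meaningless.
\<close>

definition renyi_entropy :: "real \<Rightarrow> 'a measure \<Rightarrow> ('a \<Rightarrow> 'b::euclidean_space) \<Rightarrow> ereal" where
  "renyi_entropy r M X =
     ereal (1 / (1 - r)) *
     ln_ereal (\<integral>\<^sup>+x. ennreal (enn2real (RN_deriv lborel (distr M lborel X) x) powr r) \<partial>lborel)"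

lemma renyi_entropy_distributed:
  fixes f :: "'b::euclidean_space \<Rightarrow> real"
  assumes "distributed M lborel X (\<lambda>x. ennreal (f x))" and "\<And>x. 0 \<le> f x"
  shows "renyi_entropy r M X =
    ereal (1 / (1 - r)) * ln_ereal (\<integral>\<^sup>+x. ennreal (f x powr r) \<partial>lborel)"
proof -
  have f: "(\<lambda>x. ennreal (f x)) \<in> borel_measurable lborel"
    and d: "density lborel (\<lambda>x. ennreal (f x)) = distr M lborel X"
    using assms(1) by (auto simp: distributed_def)
  have "AE x in lborel. ennreal (f x) = RN_deriv lborel (distr M lborel X) x"
    by (rule sigma_finite_measure.RN_deriv_unique[OF sigma_finite_lborel f d])
  then have "AE x in lborel.
      ennreal (enn2real (RN_deriv lborel (distr M lborel X) x) powr r) = ennreal (f x powr r)"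
    by eventually_elim (metis assms(2) enn2real_ennreal)
  then show ?thesis
    unfolding renyi_entropy_def by (simp only: nn_integral_cong_AE)
qed

definition unimodal :: "('b::real_vector \<Rightarrow> real) \<Rightarrow> bool" where
  "unimodal f \<longleftrightarrow> (\<forall>t. convex {x. f x > t})"

definition spherically_symmetric :: "('b::real_inner \<Rightarrow> real) \<Rightarrow> bool" where
  "spherically_symmetric f \<longleftrightarrow> (\<forall>T. orthogonal_transformation T \<longrightarrow> (\<forall>x. f (T x) = f x))"

definition compactly_supported :: "('b::topological_space \<Rightarrow> real) \<Rightarrow> bool" where
  "compactly_supported f \<longleftrightarrow> compact (closure {x. f x \<noteq> 0})"

definition covariance_matrix :: "'a measure \<Rightarrow> ('a \<Rightarrow> real ^ 'd) \<Rightarrow> real ^ 'd ^ 'd" where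
  "covariance_matrix M X =
     (\<chi> i j. \<integral>\<omega>. (X \<omega> $ i - (\<integral>\<omega>'. X \<omega>' $ i \<partial>M)) * (X \<omega> $ j - (\<integral>\<omega>'. X \<omega>' $ j \<partial>M)) \<partial>M)"

definition gaussian_density :: "real ^ 'd \<Rightarrow> real ^ 'd ^ 'd \<Rightarrow> real ^ 'd \<Rightarrow> real" where
  "gaussian_density \<mu> K x =
     exp (- ((x - \<mu>) \<bullet> (matrix_inv K *v (x - \<mu>))) / 2) / sqrt ((2 * pi) ^ CARD('d) * det K)"

text \<open>
  The nondegenerate Gaussian law with mean \<open>\<mu>\<close> and covariance matrix \<open>K\<close>. If \<open>K\<close> is singular, the
  denominator of the density is \<open>0\<close> and hence so is the density, and no random vector on a
  probability space satisfies the predicate.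
\<close>

definition gaussian_vector ::
  "'a measure \<Rightarrow> ('a \<Rightarrow> real ^ 'd) \<Rightarrow> real ^ 'd \<Rightarrow> real ^ 'd ^ 'd \<Rightarrow> bool" where
  "gaussian_vector M Z \<mu> K \<longleftrightarrow>
     distributed M lborel Z (\<lambda>x. ennreal (gaussian_density \<mu> K x))"

end

theory Submission
  imports Defs
begin

text \<open>
  Write \<open>h n\<close> for the density of \<open>Z n\<close>. The entropy is a continuous function of the integral of
  \<open>h n powr r\<close>, so this integral has to converge to the one for the Gaussian density \<open>\<phi>\<close>. For \<open>r < 1\<close>
  two facts suffice: pointwise convergence \<open>h n x \<longlonglongrightarrow> \<phi> x\<close> almost everywhere, and a bound, uniform in
  \<open>n\<close>, on the exponential moment of \<open>norm (Z n)\<close>. Relative to a finite measure with exponentially small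
  tails, the moment bound becomes an \<open>L\<^sup>1\<close> bound, and an \<open>L\<^sup>1\<close> bound makes \<open>r\<close>-th powers with \<open>r < 1\<close> uniformly
  integrable (\<open>integral_powr_tendsto\<close>, \<open>density_powr_tendsto\<close>). This takes care both of the tails and
  of a possible peak of \<open>h n\<close> at the origin, where no uniform bound is at hand.

  The moment bound follows from Hoeffding's lemma, because the summands are bounded. Pointwise
  convergence is the point where the shape of the density enters. A spherically symmetric unimodal
  density is a nonincreasing function of the norm, and this property survives convolution
  (\<open>convolution_radially_antimono\<close>), by a reflection argument. So all \<open>h n\<close> are radially
  nonincreasing, and for such densities weak convergence implies pointwise convergence away from the
  origin (\<open>radially_antimono_density_tendsto\<close>): the value on a sphere is squeezed between averages
  over thin shells on its two sides.

  The weak convergence that is needed concerns radial test functions only. The one-dimensional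
  central limit theorem, applied in each direction, gives convergence of the characteristic
  functions. Integrating them against a Gaussian weight yields convergence of the expectations of
  \<open>exp (- k * (norm (Z n))\<^sup>2 / 2)\<close> for all natural numbers \<open>k\<close>. These are the moments of
  \<open>exp (- (norm (Z n))\<^sup>2 / 2)\<close>, which takes values in the unit interval, and the Weierstrass
  approximation theorem extends the convergence to all continuous functions of it
  (\<open>radial_test_function_tendsto\<close>). Spherical symmetry makes the covariance matrix a multiple of the
  identity (\<open>isotropic_second_moment\<close>), so the limit density \<open>\<phi>\<close> is radially nonincreasing as well.
\<close>

section \<open>Radially nonincreasing functions and convolution\<close>

lemma lborel_distr_add: "distr lborel borel (\<lambda>x. c + x) = (lborel :: 'b::euclidean_space measure)"
  using lborel_affine[of 1 c] by (simp add: density_1)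

lemma lborel_distr_scaleR:
  fixes c :: real
  assumes "c \<noteq> 0"
  shows "lborel = density (distr lborel borel (\<lambda>x::'b::euclidean_space. c *\<^sub>R x)) (\<lambda>_. \<bar>c\<bar> ^ DIM('b))"
  using lborel_affine[OF assms, of 0] by simp

lemma nn_integral_lborel_translate:
  fixes f :: "'b::euclidean_space \<Rightarrow> ennreal"
  assumes [measurable]: "f \<in> borel_measurable borel"
  shows "(\<integral>\<^sup>+x. f (c + x) \<partial>lborel) = (\<integral>\<^sup>+x. f x \<partial>lborel)"
proof -
  have "(\<integral>\<^sup>+x. f x \<partial>distr lborel borel (\<lambda>x. c + x)) = (\<integral>\<^sup>+x. f (c + x) \<partial>lborel)"
    by (rule nn_integral_distr) auto
  then show ?thesis by (simp add: lborel_distr_add)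
qed

lemma nn_integral_lborel_scaleR:
  fixes f :: "'b::euclidean_space \<Rightarrow> ennreal"
  assumes [measurable]: "f \<in> borel_measurable borel" and "c \<noteq> 0"
  shows "(\<integral>\<^sup>+x. f x \<partial>lborel) = ennreal (\<bar>c\<bar> ^ DIM('b)) * (\<integral>\<^sup>+x. f (c *\<^sub>R x) \<partial>lborel)"
  by (subst lborel_distr_scaleR[OF assms(2)])
    (simp add: nn_integral_density nn_integral_distr nn_integral_cmult ennreal_power)

text \<open>
  The argument behind the uniqueness of Haar measure. Let \<open>\<mu>\<close> be the image of Lebesgue measure
  under \<open>T\<close>; it is translation invariant, because \<open>T\<close> is linear and onto. Computing the integral of
  \<open>f (x + y) * g y\<close> over the product of the two measures in both orders gives
  \<open>\<integral>f d\<mu> * \<integral>g dx = \<integral>f dx * \<integral>g d\<mu>\<close> for even \<open>g\<close>. The indicator \<open>g\<close> of the unit ball is invariant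
  under \<open>T\<close>, so its two integrals agree and can be cancelled.
\<close>

lemma nn_integral_lborel_isometry:
  fixes T :: "'b::euclidean_space \<Rightarrow> 'b" and f :: "'b \<Rightarrow> ennreal"
  assumes T: "linear T" and iso: "\<And>x. norm (T x) = norm x"
    and [measurable]: "f \<in> borel_measurable borel"
  shows "(\<integral>\<^sup>+x. f (T x) \<partial>lborel) = (\<integral>\<^sup>+x. f x \<partial>lborel)"
proof -
  interpret T: linear T by fact
  have [measurable]: "T \<in> borel_measurable borel"
    using linear_continuous_on[of T] T linear_conv_bounded_linear by (intro borel_measurable_continuous_onI) auto
  define g where "g = (indicator (ball 0 1) :: 'b \<Rightarrow> ennreal)"
  have [measurable]: "g \<in> borel_measurable borel" unfolding g_def
    by (rule borel_measurable_indicator) simp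
  have "inj T" using iso T.inj_iff_eq_0 by (metis norm_eq_zero)
  then have "surj T" using T linear_injective_imp_surjective by blast
  have gT: "g (T x) = g x" "g (- x) = g x" for x by (auto simp: g_def indicator_def iso)
  let ?G = "\<integral>\<^sup>+x. g x \<partial>lborel"
  have G: "?G = emeasure lborel (ball (0::'b) 1)" by (simp add: g_def)
  have "?G \<noteq> 0" "?G < \<infinity>"
    using emeasure_lborel_ball_finite[of "0::'b" 1]
    using less_imp_neq[OF unit_ball_vol_pos[of "real DIM('b)"]]
    by (auto simp: G emeasure_ball less_top)
  have "(\<integral>\<^sup>+x. f (T x) \<partial>lborel) * ?G = (\<integral>\<^sup>+y. (\<integral>\<^sup>+x. f (T x) * g y \<partial>lborel) \<partial>lborel)"
    by (simp add: nn_integral_multc nn_integral_cmult)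
  \<comment> \<open>Adding \<open>y\<close> to \<open>T x\<close> amounts to translating \<open>x\<close> by a preimage of \<open>y\<close>.\<close>
  also have "\<dots> = (\<integral>\<^sup>+y. (\<integral>\<^sup>+x. f (T x + y) * g y \<partial>lborel) \<partial>lborel)"
  proof (rule nn_integral_cong)
    fix y :: 'b
    obtain z where z: "y = T z" using \<open>surj T\<close> by blast
    show "(\<integral>\<^sup>+x. f (T x) * g y \<partial>lborel) = (\<integral>\<^sup>+x. f (T x + y) * g y \<partial>lborel)"
      using nn_integral_lborel_translate[of "\<lambda>x. f (T x) * g y" z]
      by (simp add: z T.add add.commute)
  qed
  also have "\<dots> = (\<integral>\<^sup>+x. (\<integral>\<^sup>+y. f (T x + y) * g y \<partial>lborel) \<partial>lborel)"
    by (rule lborel_pair.Fubini') measurable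
  also have "\<dots> = (\<integral>\<^sup>+x. (\<integral>\<^sup>+y. f y * g (y - T x) \<partial>lborel) \<partial>lborel)"
  proof (rule nn_integral_cong)
    fix x :: 'b
    show "(\<integral>\<^sup>+y. f (T x + y) * g y \<partial>lborel) = (\<integral>\<^sup>+y. f y * g (y - T x) \<partial>lborel)"
      using nn_integral_lborel_translate[of "\<lambda>y. f y * g (y - T x)" "T x"] by simp
  qed
  also have "\<dots> = (\<integral>\<^sup>+y. (\<integral>\<^sup>+x. f y * g (y - T x) \<partial>lborel) \<partial>lborel)"
    by (rule lborel_pair.Fubini') measurable
  also have "\<dots> = (\<integral>\<^sup>+y. f y * ?G \<partial>lborel)"
  proof (rule nn_integral_cong)
    fix y :: 'b
    obtain z where z: "y = T z" using \<open>surj T\<close> by blast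
    have "g (y - T x) = g (- z + x)" for x
      using gT(1)[of "z - x"] gT(2)[of "z - x"] by (simp add: z T.diff)
    then show "(\<integral>\<^sup>+x. f y * g (y - T x) \<partial>lborel) = f y * ?G"
      using nn_integral_lborel_translate[of g "- z"] by (simp add: nn_integral_cmult)
  qed
  also have "\<dots> = (\<integral>\<^sup>+x. f x \<partial>lborel) * ?G" by (simp add: nn_integral_multc)
  finally show ?thesis
    using \<open>?G \<noteq> 0\<close> \<open>?G < \<infinity>\<close> by (auto simp: mult.commute[of _ ?G] ennreal_mult_cancel_left)
qed

definition radially_antimono :: "('b::real_normed_vector \<Rightarrow> real) \<Rightarrow> bool" where
  "radially_antimono f \<longleftrightarrow> (\<forall>x y. norm x \<le> norm y \<longrightarrow> f y \<le> f x)"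

lemma radially_antimonoD: "radially_antimono f \<Longrightarrow> norm x \<le> norm y \<Longrightarrow> f y \<le> f x"
  by (auto simp: radially_antimono_def)

lemma radially_antimono_norm_eq: "radially_antimono f \<Longrightarrow> norm x = norm y \<Longrightarrow> f x = f y"
  by (simp add: radially_antimonoD antisym)

text \<open>
  The map is the reflection in the hyperplane that bisects the segment from \<open>x\<close> to \<open>x'\<close>. The origin
  lies on the same side as \<open>x\<close>, so points on that side move away from the origin, and points on the
  other side move towards it. For \<open>x = x'\<close> the identity will do.
\<close>

lemma exists_bisecting_reflection:
  fixes x x' :: "'b::euclidean_space"
  assumes le: "norm x \<le> norm x'"
  obtains R :: "'b \<Rightarrow> 'b"
  where "R \<in> borel_measurable borel"
    and "\<And>f. f \<in> borel_measurable borel \<Longrightarrow> (\<integral>\<^sup>+y. f (R y) \<partial>lborel) = (\<integral>\<^sup>+y. f y \<partial>lborel)"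
    and "\<And>y. norm (x - R y) = norm (x' - y)" and "\<And>y. norm (x' - R y) = norm (x - y)"
    and "\<And>y. norm (x - y) \<le> norm (x' - y) \<Longrightarrow> norm y \<le> norm (R y)"
    and "\<And>y. norm (x' - y) \<le> norm (x - y) \<Longrightarrow> norm (R y) \<le> norm y"
proof (cases "x = x'")
  case True
  then show ?thesis using that[of id] by auto
next
  case False
  define v where "v = x' - x"
  define T where "T y = y - (2 * (y \<bullet> v) / (v \<bullet> v)) *\<^sub>R v" for y
  define w where "w = (((x + x') \<bullet> v) / (v \<bullet> v)) *\<^sub>R v"
  define R where "R y = w + T y" for y
  have vv: "v \<bullet> v > 0" using False by (simp add: v_def)
  have T: "linear T"
    unfolding T_def by (intro linearI) (auto simp: inner_add_left algebra_simps add_divide_distrib)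
  have iso: "norm (T y) = norm y" for y
    unfolding norm_eq T_def using vv
    by (simp add: inner_diff_left inner_diff_right inner_commute power2_eq_square field_simps)
  have R_eq: "R y = y + (((x + x') \<bullet> v - 2 * (y \<bullet> v)) / (v \<bullet> v)) *\<^sub>R v" for y
    unfolding R_def w_def T_def diff_divide_distrib scaleR_diff_left by simp
  have "(x + x') \<bullet> v - 2 * (x \<bullet> v) = v \<bullet> v" "(x + x') \<bullet> v - 2 * (x' \<bullet> v) = - (v \<bullet> v)"
    by (simp_all add: v_def algebra_simps)
  then have "R x = x + v" "R x' = x' - v" using vv R_eq[of x] R_eq[of x'] by simp_all
  then have Rx: "R x = x'" and Rx': "R x' = x" unfolding v_def by simp_all
  have distR: "norm (R a - R b) = norm (a - b)" for a b
    using iso[of "a - b"] linear_diff[OF T, of a b] by (simp add: R_def)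
  \<comment> \<open>This identity yields both monotonicity claims: the second factor is nonnegative, and the sign
    of the first one tells on which side of the hyperplane \<open>y\<close> lies.\<close>
  have sq: "(norm (R y))\<^sup>2 - (norm y)\<^sup>2
      = ((norm (x' - y))\<^sup>2 - (norm (x - y))\<^sup>2) * ((norm x')\<^sup>2 - (norm x)\<^sup>2) / (v \<bullet> v)" for y
  proof -
    define c where "c = ((x + x') \<bullet> v - 2 * (y \<bullet> v)) / (v \<bullet> v)"
    have cv: "c * (v \<bullet> v) = (x + x') \<bullet> v - 2 * (y \<bullet> v)" using vv by (simp add: c_def)
    have "R y = y + c *\<^sub>R v" by (simp add: R_eq c_def)
    then have "(norm (R y))\<^sup>2 - (norm y)\<^sup>2 = 2 * c * (y \<bullet> v) + c * (c * (v \<bullet> v))"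
      by (simp add: power2_norm_eq_inner inner_add_left inner_add_right inner_commute algebra_simps)
    also have "\<dots> = c * ((x + x') \<bullet> v)" unfolding cv by (simp add: algebra_simps)
    also have "(x + x') \<bullet> v = (norm x')\<^sup>2 - (norm x)\<^sup>2"
      by (simp add: v_def power2_norm_eq_inner inner_commute algebra_simps)
    also have "c = ((norm (x' - y))\<^sup>2 - (norm (x - y))\<^sup>2) / (v \<bullet> v)"
      by (simp add: c_def v_def power2_norm_eq_inner inner_commute algebra_simps)
    finally show ?thesis by simp
  qed
  have gap: "0 \<le> (norm x')\<^sup>2 - (norm x)\<^sup>2" using le by (simp add: power_mono)
  show ?thesis
  proof (rule that[of R])
    have [measurable]: "T \<in> borel_measurable borel"
      using linear_continuous_on[of T] T linear_conv_bounded_linear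
      by (intro borel_measurable_continuous_onI) auto
    show "R \<in> borel_measurable borel" unfolding R_def by measurable
    fix f :: "'b \<Rightarrow> ennreal" assume f[measurable]: "f \<in> borel_measurable borel"
    show "(\<integral>\<^sup>+y. f (R y) \<partial>lborel) = (\<integral>\<^sup>+y. f y \<partial>lborel)"
      using nn_integral_lborel_isometry[OF T iso, of "\<lambda>y. f (w + y)"] nn_integral_lborel_translate[OF f]
      by (simp add: R_def)
  next
    fix y
    show "norm (x - R y) = norm (x' - y)" using distR[of x' y] by (simp add: Rx')
    show "norm (x' - R y) = norm (x - y)" using distR[of x y] by (simp add: Rx)
    show "norm y \<le> norm (R y)" if "norm (x - y) \<le> norm (x' - y)"
    proof -
      have "0 \<le> (norm (x' - y))\<^sup>2 - (norm (x - y))\<^sup>2" using that by (simp add: power_mono)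
      then have "0 \<le> (norm (R y))\<^sup>2 - (norm y)\<^sup>2" unfolding sq using gap vv by simp
      then show ?thesis by (intro power2_le_imp_le[OF _ norm_ge_zero]) simp
    qed
    show "norm (R y) \<le> norm y" if "norm (x' - y) \<le> norm (x - y)"
    proof -
      have "(norm (x' - y))\<^sup>2 - (norm (x - y))\<^sup>2 \<le> 0" using that by (simp add: power_mono)
      then have "(norm (R y))\<^sup>2 - (norm y)\<^sup>2 \<le> 0" unfolding sq using gap vv
        by (simp add: divide_nonpos_nonneg mult_nonpos_nonneg)
      then show ?thesis by (intro power2_le_imp_le[OF _ norm_ge_zero]) simp
    qed
  qed
qed

text \<open>
  Average the integrand over \<open>y\<close> and its mirror image \<open>R y\<close> under the reflection that exchanges \<open>x\<close>
  and \<open>x'\<close>. Both factors prefer the same one of the two mirror points when the convolution is taken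
  at \<open>x\<close>, and opposite ones at \<open>x'\<close>. So the inequality already holds pointwise, as the rearrangement
  inequality for two pairs of numbers.
\<close>

lemma convolution_radially_antimono:
  fixes f g :: "'b::euclidean_space \<Rightarrow> real"
  assumes f: "radially_antimono f" and g: "radially_antimono g"
    and f0: "\<And>x. 0 \<le> f x" and g0: "\<And>x. 0 \<le> g x"
    and [measurable]: "f \<in> borel_measurable borel" "g \<in> borel_measurable borel"
    and le: "norm x \<le> norm x'"
  shows "(\<integral>\<^sup>+y. ennreal (f y * g (x' - y)) \<partial>lborel) \<le> (\<integral>\<^sup>+y. ennreal (f y * g (x - y)) \<partial>lborel)"
    (is "?I x' \<le> ?I x")
proof -
  obtain R :: "'b \<Rightarrow> 'b" where R[measurable]: "R \<in> borel_measurable borel"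
    and inv: "\<And>f. f \<in> borel_measurable borel \<Longrightarrow> (\<integral>\<^sup>+y. f (R y) \<partial>lborel) = (\<integral>\<^sup>+y. f y \<partial>lborel)"
    and swap: "\<And>y. norm (x - R y) = norm (x' - y)" "\<And>y. norm (x' - R y) = norm (x - y)"
    and near: "\<And>y. norm (x - y) \<le> norm (x' - y) \<Longrightarrow> norm y \<le> norm (R y)"
    and far: "\<And>y. norm (x' - y) \<le> norm (x - y) \<Longrightarrow> norm (R y) \<le> norm y"
    by (rule exists_bisecting_reflection[OF le]) blast
  have twice: "2 * ?I z = (\<integral>\<^sup>+y. ennreal (f y * g (z - y) + f (R y) * g (z - R y)) \<partial>lborel)" for z
  proof -
    have "2 * ?I z = ?I z + (\<integral>\<^sup>+y. ennreal (f (R y) * g (z - R y)) \<partial>lborel)"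
      using inv[of "\<lambda>y. ennreal (f y * g (z - y))"] by (simp add: mult_2)
    also have "\<dots> = (\<integral>\<^sup>+y. ennreal (f y * g (z - y)) + ennreal (f (R y) * g (z - R y)) \<partial>lborel)"
      by (rule nn_integral_add[symmetric]) measurable
    finally show ?thesis using f0 g0 by (simp add: ennreal_plus)
  qed
  have eq: "g (x - R y) = g (x' - y)" "g (x' - R y) = g (x - y)" for y
    by (rule radially_antimono_norm_eq[OF g swap(1)], rule radially_antimono_norm_eq[OF g swap(2)])
  have "f y * g (x' - y) + f (R y) * g (x' - R y) \<le> f y * g (x - y) + f (R y) * g (x - R y)" for y
  proof -
    have "0 \<le> (f y - f (R y)) * (g (x - y) - g (x' - y))"
    proof (cases "norm (x - y) \<le> norm (x' - y)")
      case True
      then show ?thesis using near radially_antimonoD[OF f] radially_antimonoD[OF g] by simp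
    next
      case False
      then show ?thesis using far radially_antimonoD[OF f] radially_antimonoD[OF g]
        by (simp add: mult_nonpos_nonpos)
    qed
    then show ?thesis unfolding eq by (simp add: algebra_simps)
  qed
  then have "2 * ?I x' \<le> 2 * ?I x" unfolding twice by (intro nn_integral_mono ennreal_leI)
  then show ?thesis by (simp add: ennreal_mult_le_mult_iff)
qed

section \<open>Densities of normalized sums\<close>

lemma (in prob_space) distributed_add_indep:
  fixes X Y :: "'a \<Rightarrow> 'b::euclidean_space"
  assumes indep: "indep_var borel X borel Y"
    and X: "distributed M lborel X f" and Y: "distributed M lborel Y g"
  shows "distributed M lborel (\<lambda>\<omega>. X \<omega> + Y \<omega>) (\<lambda>z. \<integral>\<^sup>+y. f y * g (z - y) \<partial>lborel)"
  unfolding distributed_def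
proof (intro conjI)
  have [measurable]: "f \<in> borel_measurable borel" "g \<in> borel_measurable borel"
      "X \<in> borel_measurable M" "Y \<in> borel_measurable M"
    using X Y by (auto simp: distributed_def)
  show "(\<lambda>z. \<integral>\<^sup>+y. f y * g (z - y) \<partial>lborel) \<in> borel_measurable lborel"
    "(\<lambda>\<omega>. X \<omega> + Y \<omega>) \<in> M \<rightarrow>\<^sub>M lborel"
    by simp_all
  have law: "distr M borel X = density lborel f" "distr M borel Y = density lborel g"
    using X Y by (simp_all add: distributed_def cong: distr_cong)
  have pair: "distr M (borel \<Otimes>\<^sub>M borel) (\<lambda>\<omega>. (X \<omega>, Y \<omega>)) = density lborel f \<Otimes>\<^sub>M density lborel g"
    using indep unfolding indep_var_distribution_eq law by simp
  have pg: "prob_space (density lborel g)"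
    unfolding law[symmetric] by (auto intro!: prob_space_distr)
  interpret pg: prob_space "density lborel g" by (rule pg)
  show "distr M lborel (\<lambda>\<omega>. X \<omega> + Y \<omega>) = density lborel (\<lambda>z. \<integral>\<^sup>+y. f y * g (z - y) \<partial>lborel)"
  proof (rule measure_eqI)
    fix A assume "A \<in> sets (distr M lborel (\<lambda>\<omega>. X \<omega> + Y \<omega>))"
    then have A[measurable]: "A \<in> sets borel" by simp
    let ?i = "indicator A :: 'b \<Rightarrow> ennreal"
    have "emeasure (distr M lborel (\<lambda>\<omega>. X \<omega> + Y \<omega>)) A = (\<integral>\<^sup>+z. ?i z \<partial>distr M lborel (\<lambda>\<omega>. X \<omega> + Y \<omega>))"
      by simp
    also have "\<dots> = (\<integral>\<^sup>+\<omega>. ?i (X \<omega> + Y \<omega>) \<partial>M)"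
      by (subst nn_integral_distr) auto
    also have "\<dots> = (\<integral>\<^sup>+p. ?i (fst p + snd p) \<partial>distr M (borel \<Otimes>\<^sub>M borel) (\<lambda>\<omega>. (X \<omega>, Y \<omega>)))"
      by (subst nn_integral_distr) auto
    also have "\<dots> = (\<integral>\<^sup>+x. (\<integral>\<^sup>+y. ?i (x + y) \<partial>density lborel g) \<partial>density lborel f)"
      unfolding pair by (subst pg.nn_integral_fst[symmetric]) auto
    also have "\<dots> = (\<integral>\<^sup>+x. (\<integral>\<^sup>+y. f x * (g y * ?i (x + y)) \<partial>lborel) \<partial>lborel)"
      by (simp add: nn_integral_density nn_integral_cmult)
    also have "\<dots> = (\<integral>\<^sup>+x. (\<integral>\<^sup>+z. f x * g (z - x) * ?i z \<partial>lborel) \<partial>lborel)"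
    proof (rule nn_integral_cong)
      fix x
      show "(\<integral>\<^sup>+y. f x * (g y * ?i (x + y)) \<partial>lborel) = (\<integral>\<^sup>+z. f x * g (z - x) * ?i z \<partial>lborel)"
        using nn_integral_lborel_translate[of "\<lambda>z. f x * g (z - x) * ?i z" x] by (simp add: mult.assoc)
    qed
    also have "\<dots> = (\<integral>\<^sup>+z. (\<integral>\<^sup>+x. f x * g (z - x) * ?i z \<partial>lborel) \<partial>lborel)"
      by (rule lborel_pair.Fubini') measurable
    also have "\<dots> = emeasure (density lborel (\<lambda>z. \<integral>\<^sup>+y. f y * g (z - y) \<partial>lborel)) A"
      by (simp add: emeasure_density nn_integral_multc)
    finally show "emeasure (distr M lborel (\<lambda>\<omega>. X \<omega> + Y \<omega>)) A
      = emeasure (density lborel (\<lambda>z. \<integral>\<^sup>+y. f y * g (z - y) \<partial>lborel)) A" .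
  qed simp
qed

lemma (in prob_space) distributed_scaleR:
  fixes X :: "'a \<Rightarrow> 'b::euclidean_space" and f :: "'b \<Rightarrow> real"
  assumes X: "distributed M lborel X (\<lambda>x. ennreal (f x))" and c: "0 < c"
  shows "distributed M lborel (\<lambda>\<omega>. c *\<^sub>R X \<omega>) (\<lambda>x. ennreal ((1 / c) ^ DIM('b) * f ((1 / c) *\<^sub>R x)))"
  unfolding distributed_def
proof (intro conjI)
  have m[measurable]: "(\<lambda>x. ennreal (f x)) \<in> borel_measurable borel" "X \<in> borel_measurable M"
    using X by (auto simp: distributed_def)
  have eq: "ennreal ((1 / c) ^ DIM('b) * f ((1 / c) *\<^sub>R x))
      = ennreal ((1 / c) ^ DIM('b)) * ennreal (f ((1 / c) *\<^sub>R x))" for x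
    using c by (subst ennreal_mult') auto
  show "(\<lambda>x. ennreal ((1 / c) ^ DIM('b) * f ((1 / c) *\<^sub>R x))) \<in> borel_measurable lborel"
    unfolding eq by measurable
  show "(\<lambda>\<omega>. c *\<^sub>R X \<omega>) \<in> M \<rightarrow>\<^sub>M lborel" by simp
  show "distr M lborel (\<lambda>\<omega>. c *\<^sub>R X \<omega>) = density lborel (\<lambda>x. ennreal ((1 / c) ^ DIM('b) * f ((1 / c) *\<^sub>R x)))"
  proof (rule measure_eqI)
    fix A assume "A \<in> sets (distr M lborel (\<lambda>\<omega>. c *\<^sub>R X \<omega>))"
    then have A[measurable]: "A \<in> sets borel" by simp
    let ?i = "indicator A :: 'b \<Rightarrow> ennreal"
    have "emeasure (distr M lborel (\<lambda>\<omega>. c *\<^sub>R X \<omega>)) A = (\<integral>\<^sup>+z. ?i z \<partial>distr M lborel (\<lambda>\<omega>. c *\<^sub>R X \<omega>))"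
      by simp
    also have "\<dots> = (\<integral>\<^sup>+\<omega>. ?i (c *\<^sub>R X \<omega>) \<partial>M)"
      by (subst nn_integral_distr) auto
    also have "\<dots> = (\<integral>\<^sup>+x. ennreal (f x) * ?i (c *\<^sub>R x) \<partial>lborel)"
      using distributed_nn_integral[OF X, of "\<lambda>x. ?i (c *\<^sub>R x)"] by simp
    also have "\<dots> = ennreal ((1 / c) ^ DIM('b)) * (\<integral>\<^sup>+x. ennreal (f ((1 / c) *\<^sub>R x)) * ?i x \<partial>lborel)"
      using c by (subst nn_integral_lborel_scaleR[where c = "1 / c"]) auto
    also have "\<dots> = (\<integral>\<^sup>+x. ennreal ((1 / c) ^ DIM('b) * f ((1 / c) *\<^sub>R x)) * ?i x \<partial>lborel)"
      by (subst nn_integral_cmult[symmetric]) (auto simp: eq mult.assoc)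
    also have "\<dots> = emeasure (density lborel (\<lambda>x. ennreal ((1 / c) ^ DIM('b) * f ((1 / c) *\<^sub>R x)))) A"
      by (subst emeasure_density) (auto simp: eq)
    finally show "emeasure (distr M lborel (\<lambda>\<omega>. c *\<^sub>R X \<omega>)) A
      = emeasure (density lborel (\<lambda>x. ennreal ((1 / c) ^ DIM('b) * f ((1 / c) *\<^sub>R x)))) A" .
  qed simp
qed

lemma (in prob_space) indep_var_sum_next:
  fixes X :: "nat \<Rightarrow> 'a \<Rightarrow> 'b::euclidean_space"
  assumes "indep_vars (\<lambda>_. borel) X UNIV"
  shows "indep_var borel (\<lambda>\<omega>. \<Sum>i<n. X i \<omega>) borel (X n)"
proof -
  have "indep_vars (\<lambda>_. borel) X ({..<n} \<union> {n})"
    by (rule indep_vars_subset[OF assms]) simp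
  then have "indep_var
    borel ((\<lambda>f. \<Sum>i<n. f i) \<circ> (\<lambda>\<omega>. restrict (\<lambda>i. X i \<omega>) {..<n}))
    borel ((\<lambda>f. f n) \<circ> (\<lambda>\<omega>. restrict (\<lambda>i. X i \<omega>) {n}))"
    by (intro indep_var_compose[OF indep_var_restrict[where I = "{..<n} \<union> {n}"]]) auto
  also have "((\<lambda>f. \<Sum>i<n. f i) \<circ> (\<lambda>\<omega>. restrict (\<lambda>i. X i \<omega>) {..<n})) = (\<lambda>\<omega>. \<Sum>i<n. X i \<omega>)"
    by (auto simp: fun_eq_iff)
  also have "((\<lambda>f. f n) \<circ> (\<lambda>\<omega>. restrict (\<lambda>i. X i \<omega>) {n})) = X n"
    by auto
  finally show ?thesis .
qed

lemma (in prob_space) distributed_real_nn_integral: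
  fixes f :: "'b::euclidean_space \<Rightarrow> real"
  assumes "distributed M lborel X (\<lambda>x. ennreal (f x))"
  shows "(\<integral>\<^sup>+x. ennreal (f x) \<partial>lborel) = 1"
  using distributed_nn_integral[OF assms, of "\<lambda>_. 1"] by (simp add: emeasure_space_1)

text \<open>
  The predicate \<^const>\<open>distributed\<close> only gives measurability of the density as an extended nonnegative
  function.
\<close>

lemma borel_measurable_enn_nonneg:
  fixes f :: "'b \<Rightarrow> real"
  assumes "(\<lambda>x. ennreal (f x)) \<in> borel_measurable N" "\<And>x. 0 \<le> f x"
  shows "f \<in> borel_measurable N"
proof -
  have "(\<lambda>x. enn2real (ennreal (f x))) \<in> borel_measurable N" using assms(1) by measurable
  then show ?thesis using assms(2) by simp
qed

text \<open>
  The densities are obtained by repeated convolution. A radially nonincreasing density is bounded by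
  its value at the origin, and hence so is its convolution with a probability density; this is why
  the new density is again real-valued.
\<close>

lemma (in prob_space) sum_has_radially_antimono_density:
  fixes X :: "nat \<Rightarrow> 'a \<Rightarrow> 'b::euclidean_space" and f :: "'b \<Rightarrow> real"
  assumes indep: "indep_vars (\<lambda>_. borel) X UNIV"
    and X: "\<And>n. distributed M lborel (X n) (\<lambda>x. ennreal (f x))"
    and f0: "\<And>x. 0 \<le> f x" and f: "radially_antimono f"
  shows "\<exists>h. distributed M lborel (\<lambda>\<omega>. \<Sum>i<Suc n. X i \<omega>) (\<lambda>x. ennreal (h x))
    \<and> (\<forall>x. 0 \<le> h x) \<and> radially_antimono h"
proof (induction n)
  case 0
  then show ?case using X[of 0] f0 f by auto
next
  case (Suc n)
  then obtain h where h: "distributed M lborel (\<lambda>\<omega>. \<Sum>i<Suc n. X i \<omega>) (\<lambda>x. ennreal (h x))"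
    and h0: "\<And>x. 0 \<le> h x" and hr: "radially_antimono h" by blast
  have [measurable]: "f \<in> borel_measurable borel" "h \<in> borel_measurable borel"
    using X[of 0] h f0 h0 by (auto intro!: borel_measurable_enn_nonneg simp: distributed_def)
  define q where "q z = (\<integral>\<^sup>+y. ennreal (h y * f (z - y)) \<partial>lborel)" for z
  have q: "distributed M lborel (\<lambda>\<omega>. \<Sum>i<Suc (Suc n). X i \<omega>) q"
    using distributed_add_indep[OF indep_var_sum_next[OF indep, of "Suc n"] h X] h0 f0
    by (simp add: q_def[abs_def] ennreal_mult)
  have anti: "q z' \<le> q z" if "norm z \<le> norm z'" for z z'
    unfolding q_def by (rule convolution_radially_antimono[OF hr f h0 f0 _ _ that]) auto
  have "q z \<le> ennreal (f 0)" for z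
  proof -
    have "q z \<le> (\<integral>\<^sup>+y. ennreal (h y) * ennreal (f 0) \<partial>lborel)"
      unfolding q_def using h0 f0 radially_antimonoD[OF f, of 0]
      by (intro nn_integral_mono) (auto simp: ennreal_mult[symmetric] intro!: ennreal_leI mult_left_mono)
    also have "\<dots> = ennreal (f 0)"
      using distributed_real_nn_integral[OF h] by (simp add: nn_integral_multc)
    finally show ?thesis .
  qed
  then have fin: "q z < top" for z using le_less_trans ennreal_less_top by blast
  show ?case
  proof (intro exI[of _ "\<lambda>z. enn2real (q z)"] conjI)
    show "distributed M lborel (\<lambda>\<omega>. \<Sum>i<Suc (Suc n). X i \<omega>) (\<lambda>x. ennreal (enn2real (q x)))"
      using q fin by simp
    show "radially_antimono (\<lambda>z. enn2real (q z))"
      using anti fin by (auto simp: radially_antimono_def intro!: enn2real_mono)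
  qed simp
qed

lemma (in prob_space) normalized_sum_has_radially_antimono_density:
  fixes X :: "nat \<Rightarrow> 'a \<Rightarrow> 'b::euclidean_space" and f :: "'b \<Rightarrow> real"
  assumes indep: "indep_vars (\<lambda>_. borel) X UNIV"
    and X: "\<And>n. distributed M lborel (X n) (\<lambda>x. ennreal (f x))"
    and f0: "\<And>x. 0 \<le> f x" and f: "radially_antimono f" and n: "0 < n"
  shows "\<exists>h. distributed M lborel (\<lambda>\<omega>. (1 / sqrt (real n)) *\<^sub>R (\<Sum>i<n. X i \<omega>)) (\<lambda>x. ennreal (h x))
    \<and> (\<forall>x. 0 \<le> h x) \<and> radially_antimono h"
proof -
  obtain h where h: "distributed M lborel (\<lambda>\<omega>. \<Sum>i<n. X i \<omega>) (\<lambda>x. ennreal (h x))"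
    and h0: "\<And>x. 0 \<le> h x" and hr: "radially_antimono h"
    using sum_has_radially_antimono_density[OF indep X f0 f, of "n - 1"] n by auto
  show ?thesis
    using distributed_scaleR[OF h, of "1 / sqrt (real n)"] h0 hr n
    by (intro exI[of _ "\<lambda>x. sqrt (real n) ^ DIM('b) * h (sqrt (real n) *\<^sub>R x)"] conjI) (auto simp: radially_antimono_def intro!: mult_left_mono)
qed

section \<open>Convergence of radial test functions\<close>

text \<open>
  The density of the centered Gaussian law with covariance matrix \<open>s\<^sup>2\<close> times the identity.
\<close>

definition iso_gauss :: "real \<Rightarrow> 'b::euclidean_space \<Rightarrow> real" where
  "iso_gauss s x = (\<Prod>b\<in>Basis. normal_density 0 s (x \<bullet> b))"

lemma iso_gauss_nonneg: "0 \<le> iso_gauss s x"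
  by (auto simp: iso_gauss_def intro!: prod_nonneg)

lemma borel_measurable_iso_gauss [measurable]: "iso_gauss s \<in> borel_measurable borel"
  unfolding iso_gauss_def[abs_def] by measurable

lemma normal_density_fourier:
  assumes s: "0 < s"
  shows "(\<integral>x. complex_of_real (normal_density 0 s x) * iexp (a * x) \<partial>lborel) = exp (- (s * a)\<^sup>2 / 2)"
proof -
  have "(\<integral>x. complex_of_real (normal_density 0 s x) * iexp (a * x) \<partial>lborel)
      = \<bar>s\<bar> *\<^sub>R (\<integral>x. complex_of_real (normal_density 0 s (s * x)) * iexp (a * (s * x)) \<partial>lborel)"
    using lborel_integral_real_affine[of s "\<lambda>x. complex_of_real (normal_density 0 s x) * iexp (a * x)" 0] s
    by simp
  also have "\<dots> = (\<integral>x. std_normal_density x *\<^sub>R iexp ((s * a) * x) \<partial>lborel)"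
    unfolding integral_scaleR_right[symmetric]
    using s by (intro Bochner_Integration.integral_cong)
      (simp_all add: normal_density_def real_sqrt_mult scaleR_conv_of_real power_mult_distrib mult_ac)
  also have "\<dots> = char std_normal_distribution (s * a)"
    unfolding char_def by (subst integral_density) auto
  also have "\<dots> = exp (- (s * a)\<^sup>2 / 2)"
    by (simp add: char_std_normal_distribution exp_of_real[symmetric])
  finally show ?thesis by simp
qed

lemma normal_density_fourier_integrable:
  assumes s: "0 < s"
  shows "integrable lborel (\<lambda>x. complex_of_real (normal_density 0 s x) * iexp (a * x))"
  using integrable_normal_density[OF s, of 0]
  by (rule Bochner_Integration.integrable_bound) (auto simp: norm_mult)

lemma iso_gauss_fourier:
  fixes t :: "'b::euclidean_space"
  assumes s: "0 < s"
  shows "integrable lborel (\<lambda>x. complex_of_real (iso_gauss s x) * iexp (t \<bullet> x))"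
    and "(\<integral>x. complex_of_real (iso_gauss s x) * iexp (t \<bullet> x) \<partial>lborel) = exp (- (s * norm t)\<^sup>2 / 2)"
proof -
  let ?F = "\<lambda>x::'b. complex_of_real (iso_gauss s x) * iexp (t \<bullet> x)"
  let ?f = "\<lambda>b x. complex_of_real (normal_density 0 s x) * iexp ((t \<bullet> b) * x)"
  let ?P = "\<Pi>\<^sub>M b\<in>(Basis::'b set). (lborel :: real measure)"
  interpret product_sigma_finite "\<lambda>_::'b. lborel :: real measure" by standard
  have F: "?F (\<Sum>b\<in>Basis. y b *\<^sub>R b) = (\<Prod>b\<in>Basis. ?f b (y b))" for y
  proof -
    have "t \<bullet> (\<Sum>b\<in>Basis. y b *\<^sub>R b) = (\<Sum>b\<in>Basis. (t \<bullet> b) * y b)"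
      by (simp add: inner_sum_right mult.commute)
    then have "iexp (t \<bullet> (\<Sum>b\<in>Basis. y b *\<^sub>R b)) = (\<Prod>b\<in>Basis. iexp ((t \<bullet> b) * y b))"
      by (simp add: sum_distrib_left exp_sum)
    then show ?thesis by (simp add: iso_gauss_def prod.distrib)
  qed
  have [measurable]: "?F \<in> borel_measurable borel" by measurable
  have [measurable]: "(\<lambda>y. \<Sum>b\<in>Basis. y b *\<^sub>R b) \<in> ?P \<rightarrow>\<^sub>M (borel :: 'b measure)" by measurable
  have "integrable ?P (\<lambda>y. \<Prod>b\<in>Basis. ?f b (y b))"
    by (intro product_integrable_prod normal_density_fourier_integrable[OF s]) simp
  then show "integrable lborel ?F"
    by (subst lborel_eq, subst integrable_distr_eq) (simp_all only: F, measurable)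
  have "(\<integral>x. ?F x \<partial>lborel) = (\<integral>y. (\<Prod>b\<in>Basis. ?f b (y b)) \<partial>?P)"
    by (subst lborel_eq, subst integral_distr) (simp_all only: F, measurable)
  also have "\<dots> = (\<Prod>b\<in>Basis. \<integral>x. ?f b x \<partial>lborel)"
    by (intro product_integral_prod normal_density_fourier_integrable[OF s]) simp
  also have "\<dots> = (\<Prod>b\<in>(Basis::'b set). exp (complex_of_real (- (s * (t \<bullet> b))\<^sup>2 / 2)))"
    by (simp only: normal_density_fourier[OF s] exp_of_real)
  also have "\<dots> = exp (complex_of_real (\<Sum>b\<in>Basis. - (s * (t \<bullet> b))\<^sup>2 / 2))"
    unfolding of_real_sum by (rule exp_sum[symmetric]) simp
  also have "(\<Sum>b\<in>Basis. - (s * (t \<bullet> b))\<^sup>2 / 2) = - (s * norm t)\<^sup>2 / 2"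
  proof -
    have "(norm t)\<^sup>2 = (\<Sum>b\<in>Basis. (t \<bullet> b)\<^sup>2)"
      unfolding power2_norm_eq_inner by (subst euclidean_inner) (simp add: power2_eq_square)
    then show ?thesis
      by (simp add: power_mult_distrib sum_negf sum_divide_distrib sum_distrib_left)
  qed
  finally show "(\<integral>x. ?F x \<partial>lborel) = exp (- (s * norm t)\<^sup>2 / 2)" by (simp only: exp_of_real)
qed

lemma iso_gauss_cos:
  fixes t :: "'b::euclidean_space"
  assumes s: "0 < s"
  shows "(\<integral>x. iso_gauss s x * cos (t \<bullet> x) \<partial>lborel) = exp (- (s * norm t)\<^sup>2 / 2)"
proof -
  have "(\<integral>x. iso_gauss s x * cos (t \<bullet> x) \<partial>lborel)
      = (\<integral>x. Re (complex_of_real (iso_gauss s x) * iexp (t \<bullet> x)) \<partial>lborel)"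
    by (intro Bochner_Integration.integral_cong) (simp_all add: Re_exp)
  also have "\<dots> = exp (- (s * norm t)\<^sup>2 / 2)"
    unfolding integral_Re[OF iso_gauss_fourier(1)[OF s]] iso_gauss_fourier(2)[OF s] by simp
  finally show ?thesis .
qed

lemma prob_space_iso_gauss:
  assumes s: "0 < s"
  shows "prob_space (density lborel (iso_gauss s :: 'b::euclidean_space \<Rightarrow> real))"
proof (rule prob_spaceI)
  have "integrable lborel (iso_gauss s :: 'b \<Rightarrow> real)"
    using integrable_Re[OF iso_gauss_fourier(1)[OF s, of 0]] by simp
  then have "(\<integral>\<^sup>+x. ennreal (iso_gauss s (x :: 'b)) \<partial>lborel) = ennreal (\<integral>x. iso_gauss s (x :: 'b) \<partial>lborel)"
    by (intro nn_integral_eq_integral) (auto simp: iso_gauss_nonneg)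
  then show "emeasure (density lborel (\<lambda>x::'b. ennreal (iso_gauss s x))) (space (density lborel (\<lambda>x::'b. ennreal (iso_gauss s x)))) = 1"
    using iso_gauss_cos[OF s, of 0] by (simp add: emeasure_density)
qed

text \<open>
  Parseval's identity against a Gaussian weight: the Gaussian is, up to scaling, its own
  characteristic function.
\<close>

lemma (in prob_space) gaussian_transform_eq_averaged_cos:
  fixes Z :: "'a \<Rightarrow> 'b::euclidean_space"
  assumes [measurable]: "Z \<in> borel_measurable M"
  shows "expectation (\<lambda>\<omega>. exp (- (c * norm (Z \<omega>))\<^sup>2 / 2))
    = (\<integral>x. expectation (\<lambda>\<omega>. cos ((c *\<^sub>R x) \<bullet> Z \<omega>)) \<partial>density lborel (iso_gauss 1))"
proof -
  let ?G = "density lborel (iso_gauss 1 :: 'b \<Rightarrow> real)"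
  interpret G: prob_space ?G by (rule prob_space_iso_gauss) simp
  interpret P: pair_prob_space M ?G ..
  have "(\<integral>x. cos ((c *\<^sub>R x) \<bullet> z) \<partial>?G) = exp (- (c * norm z)\<^sup>2 / 2)" for z :: 'b
    using iso_gauss_cos[of 1 "c *\<^sub>R z"]
    by (subst integral_density) (auto simp: iso_gauss_nonneg inner_commute power_mult_distrib)
  then have "expectation (\<lambda>\<omega>. exp (- (c * norm (Z \<omega>))\<^sup>2 / 2))
      = expectation (\<lambda>\<omega>. \<integral>x. cos ((c *\<^sub>R x) \<bullet> Z \<omega>) \<partial>?G)" by simp
  also have "\<dots> = (\<integral>x. expectation (\<lambda>\<omega>. cos ((c *\<^sub>R x) \<bullet> Z \<omega>)) \<partial>?G)"
    by (rule P.Fubini_integral[symmetric], rule P.integrable_const_bound[where B = 1]) auto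
  finally show ?thesis .
qed

lemma gaussian_transform_tendsto:
  fixes Z :: "'a \<Rightarrow> 'b::euclidean_space" and Y :: "nat \<Rightarrow> 'c \<Rightarrow> 'b"
  assumes "prob_space M" "prob_space N"
    and [measurable]: "\<And>n. Y n \<in> borel_measurable M" "Z \<in> borel_measurable N"
    and lim: "\<And>t. (\<lambda>n. \<integral>\<omega>. cos (t \<bullet> Y n \<omega>) \<partial>M) \<longlonglongrightarrow> (\<integral>\<omega>. cos (t \<bullet> Z \<omega>) \<partial>N)"
  shows "(\<lambda>n. \<integral>\<omega>. exp (- (c * norm (Y n \<omega>))\<^sup>2 / 2) \<partial>M) \<longlonglongrightarrow> (\<integral>\<omega>. exp (- (c * norm (Z \<omega>))\<^sup>2 / 2) \<partial>N)"
proof -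
  interpret M: prob_space M by fact
  interpret N: prob_space N by fact
  interpret G: prob_space "density lborel (iso_gauss 1 :: 'b \<Rightarrow> real)"
    by (rule prob_space_iso_gauss) simp
  have bound: "\<bar>\<integral>\<omega>. cos (g \<omega>) \<partial>M\<bar> \<le> 1" for g :: "'c \<Rightarrow> real"
  proof (cases "integrable M (\<lambda>\<omega>. cos (g \<omega>))")
    case True
    have "\<bar>\<integral>\<omega>. cos (g \<omega>) \<partial>M\<bar> \<le> (\<integral>\<omega>. \<bar>cos (g \<omega>)\<bar> \<partial>M)" by (rule integral_abs_bound)
    also have "\<dots> \<le> (\<integral>\<omega>. 1 \<partial>M)" using True by (intro integral_mono) auto
    finally show ?thesis by (simp add: M.prob_space)
  qed (simp add: not_integrable_integral_eq)
  show ?thesis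
    unfolding M.gaussian_transform_eq_averaged_cos[OF assms(3)]
      N.gaussian_transform_eq_averaged_cos[OF assms(4)]
    by (rule integral_dominated_convergence[where w = "\<lambda>_. 1"]) (auto simp: lim bound simp del: inner_scaleR_left)
qed

text \<open>
  Put \<open>u z = exp (- (norm z)\<^sup>2 / 2)\<close>. The previous lemma gives convergence of all moments of the random
  variables \<open>u (Y n)\<close> with values in the unit interval, and polynomials are dense among the
  continuous functions there. So convergence of characteristic functions is upgraded to convergence
  of the expectations of radial test functions without inverting a Fourier transform.
\<close>

lemma radial_test_function_tendsto:
  fixes Z :: "'a \<Rightarrow> 'b::euclidean_space" and Y :: "nat \<Rightarrow> 'c \<Rightarrow> 'b" and q :: "real \<Rightarrow> real"
  assumes M: "prob_space M" and N: "prob_space N"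
    and [measurable]: "\<And>n. Y n \<in> borel_measurable M" "Z \<in> borel_measurable N"
    and lim: "\<And>t. (\<lambda>n. \<integral>\<omega>. cos (t \<bullet> Y n \<omega>) \<partial>M) \<longlonglongrightarrow> (\<integral>\<omega>. cos (t \<bullet> Z \<omega>) \<partial>N)"
    and q: "continuous_on UNIV q"
  shows "(\<lambda>n. \<integral>\<omega>. q (exp (- (norm (Y n \<omega>))\<^sup>2 / 2)) \<partial>M) \<longlonglongrightarrow> (\<integral>\<omega>. q (exp (- (norm (Z \<omega>))\<^sup>2 / 2)) \<partial>N)"
proof -
  interpret M: prob_space M by fact
  interpret N: prob_space N by fact
  define u where "u z = exp (- (norm z)\<^sup>2 / 2)" for z :: 'b
  have [measurable]: "u \<in> borel_measurable borel" unfolding u_def by measurable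
  have u01: "u z \<in> {0..1}" for z by (simp add: u_def)
  have cont_int: "integrable M (\<lambda>\<omega>. p (u (Y n \<omega>)))" "integrable N (\<lambda>\<omega>. p (u (Z \<omega>)))"
    if p: "continuous_on UNIV p" for p :: "real \<Rightarrow> real" and n
  proof -
    have [measurable]: "p \<in> borel_measurable borel" using p by (rule borel_measurable_continuous_onI)
    have "compact (p ` {0..1})" by (intro compact_continuous_image continuous_on_subset[OF p]) auto
    then obtain B where "\<And>v. v \<in> {0..1} \<Longrightarrow> norm (p v) \<le> B"
      by (meson bounded_iff compact_imp_bounded imageI)
    then show "integrable M (\<lambda>\<omega>. p (u (Y n \<omega>)))" "integrable N (\<lambda>\<omega>. p (u (Z \<omega>)))"
      using u01 by (auto intro!: M.integrable_const_bound[where B = B] N.integrable_const_bound[where B = B])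
  qed
  have mono: "(\<lambda>n. \<integral>\<omega>. u (Y n \<omega>) ^ k \<partial>M) \<longlonglongrightarrow> (\<integral>\<omega>. u (Z \<omega>) ^ k \<partial>N)" for k
  proof -
    have "u z ^ k = exp (- (sqrt (real k) * norm z)\<^sup>2 / 2)" for z
      by (simp add: u_def exp_of_nat_mult[symmetric] power_mult_distrib)
    then show ?thesis
      using gaussian_transform_tendsto[OF M N assms(3,4) lim, of "sqrt (real k)"] by simp
  qed
  have "(\<lambda>n. \<integral>\<omega>. q (u (Y n \<omega>)) \<partial>M) \<longlonglongrightarrow> (\<integral>\<omega>. q (u (Z \<omega>)) \<partial>N)"
  proof (rule LIMSEQ_I)
    fix e :: real assume e: "0 < e"
    obtain p where p: "real_polynomial_function p" and qp: "\<And>v. v \<in> {0..1} \<Longrightarrow> \<bar>q v - p v\<bar> < e / 3"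
      using Stone_Weierstrass_real_polynomial_function[of "{0..1::real}" q "e / 3"] e
        continuous_on_subset[OF q, of "{0..1}"] by auto
    then obtain a d where pa: "p = (\<lambda>v. \<Sum>i\<le>(d::nat). a i * v ^ i)"
      using real_polynomial_function_imp_sum by blast
    have pc: "continuous_on UNIV p" unfolding pa by (intro continuous_intros)
    have pow: "integrable M (\<lambda>\<omega>. u (Y n \<omega>) ^ i)" "integrable N (\<lambda>\<omega>. u (Z \<omega>) ^ i)" for n i
      using cont_int[of "\<lambda>v. v ^ i"] by (simp_all add: continuous_intros)
    have "(\<lambda>n. \<integral>\<omega>. p (u (Y n \<omega>)) \<partial>M) \<longlonglongrightarrow> (\<integral>\<omega>. p (u (Z \<omega>)) \<partial>N)"
    proof -
      have "(\<integral>\<omega>. p (u (Y n \<omega>)) \<partial>M) = (\<Sum>i\<le>d. a i * (\<integral>\<omega>. u (Y n \<omega>) ^ i \<partial>M))" for n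
        unfolding pa by (subst Bochner_Integration.integral_sum) (simp_all add: pow)
      moreover have "(\<integral>\<omega>. p (u (Z \<omega>)) \<partial>N) = (\<Sum>i\<le>d. a i * (\<integral>\<omega>. u (Z \<omega>) ^ i \<partial>N))"
        unfolding pa by (subst Bochner_Integration.integral_sum) (simp_all add: pow)
      ultimately show ?thesis by (auto intro!: tendsto_intros mono)
    qed
    then obtain n0 where n0: "\<And>n. n \<ge> n0 \<Longrightarrow> \<bar>(\<integral>\<omega>. p (u (Y n \<omega>)) \<partial>M) - (\<integral>\<omega>. p (u (Z \<omega>)) \<partial>N)\<bar> < e / 3"
      using LIMSEQ_D[of _ _ "e / 3"] e by (metis divide_pos_pos real_norm_def zero_less_numeral)
    have M_close: "\<bar>(\<integral>\<omega>. q (u (Y n \<omega>)) \<partial>M) - (\<integral>\<omega>. p (u (Y n \<omega>)) \<partial>M)\<bar> \<le> e / 3" for n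
    proof -
      have "\<bar>(\<integral>\<omega>. q (u (Y n \<omega>)) \<partial>M) - (\<integral>\<omega>. p (u (Y n \<omega>)) \<partial>M)\<bar>
          = \<bar>\<integral>\<omega>. q (u (Y n \<omega>)) - p (u (Y n \<omega>)) \<partial>M\<bar>"
        by (simp add: cont_int q pc)
      also have "\<dots> \<le> (\<integral>\<omega>. \<bar>q (u (Y n \<omega>)) - p (u (Y n \<omega>))\<bar> \<partial>M)" by (rule integral_abs_bound)
      also have "\<dots> \<le> (\<integral>\<omega>. e / 3 \<partial>M)"
        using qp u01 by (intro integral_mono) (auto simp: cont_int q pc intro: less_imp_le)
      finally show ?thesis by (simp add: M.prob_space)
    qed
    have N_close: "\<bar>(\<integral>\<omega>. q (u (Z \<omega>)) \<partial>N) - (\<integral>\<omega>. p (u (Z \<omega>)) \<partial>N)\<bar> \<le> e / 3"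
    proof -
      have "\<bar>(\<integral>\<omega>. q (u (Z \<omega>)) \<partial>N) - (\<integral>\<omega>. p (u (Z \<omega>)) \<partial>N)\<bar> = \<bar>\<integral>\<omega>. q (u (Z \<omega>)) - p (u (Z \<omega>)) \<partial>N\<bar>"
        by (simp add: cont_int q pc)
      also have "\<dots> \<le> (\<integral>\<omega>. \<bar>q (u (Z \<omega>)) - p (u (Z \<omega>))\<bar> \<partial>N)" by (rule integral_abs_bound)
      also have "\<dots> \<le> (\<integral>\<omega>. e / 3 \<partial>N)"
        using qp u01 by (intro integral_mono) (auto simp: cont_int q pc intro: less_imp_le)
      finally show ?thesis by (simp add: N.prob_space)
    qed
    show "\<exists>n0. \<forall>n\<ge>n0. norm ((\<integral>\<omega>. q (u (Y n \<omega>)) \<partial>M) - (\<integral>\<omega>. q (u (Z \<omega>)) \<partial>N)) < e"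
    proof (intro exI allI impI)
      fix n assume "n0 \<le> n"
      then show "norm ((\<integral>\<omega>. q (u (Y n \<omega>)) \<partial>M) - (\<integral>\<omega>. q (u (Z \<omega>)) \<partial>N)) < e"
        unfolding real_norm_def using n0[of n] M_close[of n] N_close by linarith
    qed
  qed
  then show ?thesis by (simp add: u_def)
qed

text \<open>
  The Cramer-Wold device: for fixed \<open>t\<close> only the real random variables \<open>t \<bullet> X i\<close> matter, to which the
  one-dimensional central limit theorem applies.
\<close>

lemma (in prob_space) clt_cos:
  fixes X :: "nat \<Rightarrow> 'a \<Rightarrow> 'b::euclidean_space"
  assumes indep: "indep_vars (\<lambda>_. borel) X UNIV"
    and law: "\<And>n. distr M borel (X n) = distr M borel (X 0)"
    and mean: "\<And>t. expectation (\<lambda>\<omega>. t \<bullet> X 0 \<omega>) = 0"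
    and int: "\<And>t. integrable M (\<lambda>\<omega>. (t \<bullet> X 0 \<omega>)\<^sup>2)"
    and var: "\<And>t. expectation (\<lambda>\<omega>. (t \<bullet> X 0 \<omega>)\<^sup>2) = (s * norm t)\<^sup>2"
    and s: "0 < s"
  shows "(\<lambda>n. expectation (\<lambda>\<omega>. cos (t \<bullet> ((1 / sqrt (real n)) *\<^sub>R (\<Sum>i<n. X i \<omega>)))))
    \<longlonglongrightarrow> exp (- (s * norm t)\<^sup>2 / 2)"
proof (cases "t = 0")
  case True
  then show ?thesis by (simp add: prob_space)
next
  case False
  have [measurable]: "X n \<in> borel_measurable M" for n
    using indep unfolding indep_vars_def2 by simp
  define r where "r = s * norm t"
  have r: "0 < r" using False s by (simp add: r_def)
  define Y where "Y n \<omega> = t \<bullet> X n \<omega>" for n \<omega>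
  have Ym[measurable]: "Y n \<in> borel_measurable M" for n unfolding Y_def by measurable
  have Yn: "distr M borel (Y n) = distr (distr M borel (X 0)) borel (\<lambda>x. t \<bullet> x)" for n
    unfolding law[of n, symmetric] by (subst distr_distr) (auto simp: comp_def Y_def[abs_def])
  have same: "distr M borel (Y n) = distr M borel (Y 0)" for n using Yn[of n] Yn[of 0] by simp
  have mv: "expectation (Y n) = 0" "integrable M (\<lambda>\<omega>. (Y n \<omega>)\<^sup>2)" "expectation (\<lambda>\<omega>. (Y n \<omega>)\<^sup>2) = r\<^sup>2" for n
  proof -
    have "expectation (Y n) = (\<integral>x. x \<partial>distr M borel (Y n))" by (subst integral_distr) auto
    also have "\<dots> = expectation (Y 0)" unfolding same[of n] by (subst integral_distr) auto
    finally show "expectation (Y n) = 0" using mean[of t] by (simp add: Y_def[abs_def])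
    have "integrable M (\<lambda>\<omega>. (Y n \<omega>)\<^sup>2) \<longleftrightarrow> integrable (distr M borel (Y n)) (\<lambda>x. x\<^sup>2)"
      by (subst integrable_distr_eq) auto
    also have "\<dots> \<longleftrightarrow> integrable M (\<lambda>\<omega>. (Y 0 \<omega>)\<^sup>2)" unfolding same[of n]
      by (subst integrable_distr_eq) auto
    finally show "integrable M (\<lambda>\<omega>. (Y n \<omega>)\<^sup>2)" using int[of t] by (simp add: Y_def[abs_def])
    have "expectation (\<lambda>\<omega>. (Y n \<omega>)\<^sup>2) = (\<integral>x. x\<^sup>2 \<partial>distr M borel (Y n))" by (subst integral_distr) auto
    also have "\<dots> = expectation (\<lambda>\<omega>. (Y 0 \<omega>)\<^sup>2)" unfolding same[of n] by (subst integral_distr) auto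
    finally show "expectation (\<lambda>\<omega>. (Y n \<omega>)\<^sup>2) = r\<^sup>2" using var[of t] by (simp add: Y_def[abs_def] r_def)
  qed
  have Yi: "indep_vars (\<lambda>_. borel) Y UNIV"
    unfolding Y_def[abs_def] by (rule indep_vars_compose2[OF indep]) auto
  let ?S = "\<lambda>n \<omega>. (\<Sum>i<n. Y i \<omega>) / sqrt (real n * r\<^sup>2)"
  have clt: "weak_conv_m (\<lambda>n. distr M borel (?S n)) std_normal_distribution"
    by (rule central_limit_theorem_zero_mean[OF Yi mv(1) r mv(2) _ same]) (simp add: mv)
  have rd: "real_distribution (distr M borel (?S n))" for n by (rule real_distribution_distr) auto
  have "(\<lambda>n. \<integral>x. cos (r * x) \<partial>distr M borel (?S n)) \<longlonglongrightarrow> (\<integral>x. cos (r * x) \<partial>std_normal_distribution)"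
    by (rule weak_conv_imp_integral_bdd_continuous_conv[OF rd real_dist_normal_dist clt, where B = 1]) auto
  moreover have "(\<integral>x. cos (r * x) \<partial>std_normal_distribution) = exp (- r\<^sup>2 / 2)"
    using iso_gauss_cos[of 1 r] r
    by (subst integral_density) (auto simp: iso_gauss_def)
  moreover have "(\<integral>x. cos (r * x) \<partial>distr M borel (?S n))
      = expectation (\<lambda>\<omega>. cos (t \<bullet> ((1 / sqrt (real n)) *\<^sub>R (\<Sum>i<n. X i \<omega>))))" for n
    using r by (subst integral_distr) (auto simp: Y_def inner_sum_right real_sqrt_mult)
  ultimately show ?thesis by (simp add: r_def)
qed

section \<open>Pointwise convergence of radially nonincreasing densities\<close>

text \<open>
  In the variable \<open>v = exp (- (norm y)\<^sup>2 / 2)\<close> the shell \<open>a \<le> norm y \<le> b\<close> is an interval, and \<open>q\<close> is a tent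
  over this interval.
\<close>

lemma exists_shell_test_function:
  fixes a b :: real
  assumes a: "0 \<le> a" and ab: "a < b"
  obtains q :: "real \<Rightarrow> real" where "continuous_on UNIV q" and "\<And>v. 0 \<le> q v"
    and "\<And>y :: 'b::euclidean_space. q (exp (- (norm y)\<^sup>2 / 2)) \<noteq> 0 \<Longrightarrow> a \<le> norm y \<and> norm y \<le> b"
    and "integrable lborel (\<lambda>y :: 'b. q (exp (- (norm y)\<^sup>2 / 2)))"
    and "0 < (\<integral>y. q (exp (- (norm (y :: 'b))\<^sup>2 / 2)) \<partial>lborel)"
proof
  define e where "e c = exp (- c\<^sup>2 / 2)" for c :: real
  define q where "q v = max 0 (min (v - e b) (e a - v))" for v
  define \<psi> where "\<psi> y = q (exp (- (norm y)\<^sup>2 / 2))" for y :: 'b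
  have e_less: "e c < e d \<longleftrightarrow> d < c" if "0 \<le> c" "0 \<le> d" for c d
    using that power_mono_iff[of c d 2] by (simp add: e_def flip: not_le)
  show q: "continuous_on UNIV q" unfolding q_def[abs_def] by (intro continuous_intros)
  show q0: "0 \<le> q v" for v by (simp add: q_def)
  have pos: "0 < \<psi> y \<longleftrightarrow> a < norm y \<and> norm y < b" for y
    using e_less[of b "norm y"] e_less[of "norm y" a] a ab unfolding \<psi>_def e_def[symmetric] q_def by auto
  show supp: "a \<le> norm y \<and> norm y \<le> b" if "q (exp (- (norm y)\<^sup>2 / 2)) \<noteq> 0" for y :: 'b
    using that pos[of y] q0 by (auto simp: \<psi>_def less_le)
  have cont: "continuous_on UNIV \<psi>"
    unfolding \<psi>_def[abs_def] by (intro continuous_on_compose2[OF q] continuous_intros) auto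
  have "integrable lborel (\<lambda>y. indicator (cball 0 b) y *\<^sub>R \<psi> y)"
    by (rule borel_integrable_compact[OF compact_cball continuous_on_subset[OF cont]]) simp
  also have "(\<lambda>y. indicator (cball 0 b) y *\<^sub>R \<psi> y) = \<psi>"
    using supp by (fastforce simp: \<psi>_def indicator_def)
  finally have int: "integrable lborel \<psi>" .
  then show "integrable lborel (\<lambda>y :: 'b. q (exp (- (norm y)\<^sup>2 / 2)))" by (simp add: \<psi>_def[abs_def])
  have "integral\<^sup>L lborel \<psi> \<noteq> 0"
  proof
    assume "integral\<^sup>L lborel \<psi> = 0"
    then have "AE y in lborel. \<psi> y = 0"
      using integral_nonneg_eq_0_iff_AE[OF int] q0 by (simp add: \<psi>_def)
    moreover have "closed {y. \<psi> y = 0}" using cont by (intro closed_Collect_eq continuous_intros)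
    ultimately have zero: "\<psi> y = 0" for y
      using mem_closed_if_AE_lebesgue[of "{y. \<psi> y = 0}" y] AE_completion by auto
    obtain y :: 'b where "norm y = (a + b) / 2" using vector_choose_size[of "(a + b) / 2"] a ab by auto
    then have "0 < \<psi> y" unfolding pos using ab by simp
    then show False using zero[of y] by simp
  qed
  moreover have "0 \<le> integral\<^sup>L lborel \<psi>" using q0 by (intro Bochner_Integration.integral_nonneg) (simp add: \<psi>_def)
  ultimately show "0 < (\<integral>y. q (exp (- (norm (y :: 'b))\<^sup>2 / 2)) \<partial>lborel)" by (simp add: \<psi>_def[abs_def])
qed

text \<open>
  For monotone densities weak convergence implies pointwise convergence. If \<open>\<psi>\<close> is a test function
  supported in the shell \<open>a \<le> norm y \<le> b\<close>, then the \<open>\<psi>\<close>-average of \<open>h n\<close> lies between the values of \<open>h n\<close>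
  on the outer and on the inner sphere. Thus \<open>h n\<close> on the inner sphere is at least an average that
  converges to the corresponding average of \<open>\<phi>\<close>, which is at least \<open>\<phi>\<close> on the outer sphere. Thin shells
  just outside and just inside the sphere through \<open>x\<close> give the lower and the upper bound. At the
  origin there is no inner shell, and convergence may fail.
\<close>

lemma radially_antimono_density_tendsto:
  fixes Z :: "'a \<Rightarrow> 'b::euclidean_space" and Y :: "nat \<Rightarrow> 'c \<Rightarrow> 'b"
    and h :: "nat \<Rightarrow> 'b \<Rightarrow> real" and \<phi> :: "'b \<Rightarrow> real"
  assumes M: "prob_space M" and N: "prob_space N"
    and Y: "\<And>n. distributed M lborel (Y n) (\<lambda>x. ennreal (h n x))"
    and Z: "distributed N lborel Z (\<lambda>x. ennreal (\<phi> x))"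
    and h0: "\<And>n x. 0 \<le> h n x" and hr: "\<And>n. radially_antimono (h n)"
    and \<phi>0: "\<And>x. 0 \<le> \<phi> x" and \<phi>r: "radially_antimono \<phi>" and \<phi>c: "isCont \<phi> x"
    and lim: "\<And>t. (\<lambda>n. \<integral>\<omega>. cos (t \<bullet> Y n \<omega>) \<partial>M) \<longlonglongrightarrow> (\<integral>\<omega>. cos (t \<bullet> Z \<omega>) \<partial>N)"
    and x: "x \<noteq> 0"
  shows "(\<lambda>n. h n x) \<longlonglongrightarrow> \<phi> x"
proof -
  let ?u = "\<lambda>y :: 'b. exp (- (norm y)\<^sup>2 / 2)"
  have meas [measurable]: "Y n \<in> borel_measurable M" "Z \<in> borel_measurable N"
      "h n \<in> borel_measurable borel" "\<phi> \<in> borel_measurable borel" for n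
    using Y[of n] Z h0 \<phi>0 by (auto simp: distributed_def intro!: borel_measurable_enn_nonneg)
  \<comment> \<open>Here \<open>I n\<close> and \<open>J\<close> are the integrals of the test function against \<open>h n\<close> and \<open>\<phi>\<close>, and \<open>c\<close> is its
    total mass.\<close>
  have shell: "\<exists>c I J. 0 < c \<and> I \<longlonglongrightarrow> J
      \<and> (\<forall>n p. norm p = a \<longrightarrow> I n \<le> h n p * c) \<and> (\<forall>n p. norm p = b \<longrightarrow> h n p * c \<le> I n)
      \<and> (\<forall>p. norm p = a \<longrightarrow> J \<le> \<phi> p * c) \<and> (\<forall>p. norm p = b \<longrightarrow> \<phi> p * c \<le> J)"
    if ab: "0 \<le> a" "a < b" for a b
  proof -
    obtain q :: "real \<Rightarrow> real" where qc: "continuous_on UNIV q" and q0: "\<And>v. 0 \<le> q v"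
      and supp: "\<And>y :: 'b. q (?u y) \<noteq> 0 \<Longrightarrow> a \<le> norm y \<and> norm y \<le> b"
      and int: "integrable lborel (\<lambda>y. q (?u y))" and pos: "0 < (\<integral>y. q (?u y) \<partial>lborel)"
      by (rule exists_shell_test_function[OF ab, where 'b = 'b]) blast
    have [measurable]: "q \<in> borel_measurable borel" using qc by (rule borel_measurable_continuous_onI)
    let ?c = "\<integral>y. q (?u y) \<partial>lborel"
    have bounds: "(norm p = a \<longrightarrow> (\<integral>y. k y * q (?u y) \<partial>lborel) \<le> k p * ?c)
        \<and> (norm p = b \<longrightarrow> k p * ?c \<le> (\<integral>y. k y * q (?u y) \<partial>lborel))"
      if k0: "\<And>y. 0 \<le> k y" and kr: "radially_antimono k" and [measurable]: "k \<in> borel_measurable borel"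
      for k p
    proof -
      have "integrable lborel (\<lambda>y. k 0 * q (?u y))" using int by simp
      then have kq: "integrable lborel (\<lambda>y. k y * q (?u y))"
        by (rule Bochner_Integration.integrable_bound)
          (auto intro!: mult_right_mono radially_antimonoD[OF kr] simp: abs_mult k0 q0)
      have le: "k y * q (?u y) \<le> k p * q (?u y)" if "norm p = a" for y
        using that supp[of y] q0[of "?u y"] radially_antimonoD[OF kr, of p y]
        by (cases "q (?u y) = 0") (auto intro!: mult_right_mono)
      have ge: "k p * q (?u y) \<le> k y * q (?u y)" if "norm p = b" for y
        using that supp[of y] q0[of "?u y"] radially_antimonoD[OF kr, of y p]
        by (cases "q (?u y) = 0") (auto intro!: mult_right_mono)
      show ?thesis
        using le ge kq int integral_mono[of lborel "\<lambda>y. k y * q (?u y)" "\<lambda>y. k p * q (?u y)"]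
          integral_mono[of lborel "\<lambda>y. k p * q (?u y)" "\<lambda>y. k y * q (?u y)"]
        by simp
    qed
    have "(\<lambda>n. \<integral>y. h n y * q (?u y) \<partial>lborel) \<longlonglongrightarrow> (\<integral>y. \<phi> y * q (?u y) \<partial>lborel)"
      using radial_test_function_tendsto[OF M N _ _ lim qc]
        distributed_integral[OF Y, of "\<lambda>y. q (?u y)"] distributed_integral[OF Z, of "\<lambda>y. q (?u y)"]
      by (simp add: h0 \<phi>0)
    then show ?thesis
      using pos bounds[OF h0 hr meas(3)] bounds[OF \<phi>0 \<phi>r meas(4)]
      by - (rule exI[of _ ?c], rule exI[of _ "\<lambda>n. \<integral>y. h n y * q (?u y) \<partial>lborel"],
          rule exI[of _ "\<integral>y. \<phi> y * q (?u y) \<partial>lborel"], blast)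
  qed
  \<comment> \<open>The factor \<open>\<kappa>\<close> is the ratio of the two radii of the shell.\<close>
  have ray: "((\<lambda>\<kappa>. \<phi> (\<kappa> *\<^sub>R x)) \<longlongrightarrow> \<phi> x) (at 1)"
  proof -
    have "((\<lambda>\<kappa>. \<kappa> *\<^sub>R x) \<longlongrightarrow> 1 *\<^sub>R x) (at 1)" by (intro tendsto_intros)
    then show ?thesis using isCont_tendsto_compose[OF \<phi>c] by simp
  qed
  show ?thesis
  proof (rule order_tendstoI)
    fix l assume l: "l < \<phi> x"
    have "((\<lambda>\<kappa>. \<phi> (\<kappa> *\<^sub>R x)) \<longlongrightarrow> \<phi> x) (at_right 1)"
      using ray by (rule tendsto_mono[rotated]) (simp add: at_le)
    then have "\<forall>\<^sub>F \<kappa> in at_right 1. l < \<phi> (\<kappa> *\<^sub>R x)" using l by (rule order_tendstoD)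
    moreover have "\<forall>\<^sub>F \<kappa>::real in at_right 1. 1 < \<kappa>" by (simp add: eventually_at_right_less)
    ultimately have "\<forall>\<^sub>F \<kappa> in at_right 1. l < \<phi> (\<kappa> *\<^sub>R x) \<and> 1 < \<kappa>" by (rule eventually_conj)
    then obtain \<kappa> where \<kappa>: "l < \<phi> (\<kappa> *\<^sub>R x)" "1 < \<kappa>"
      using eventually_happens'[of "at_right (1::real)"] by auto
    have ab: "0 \<le> norm x" "norm x < \<kappa> * norm x" using x \<kappa>(2) by simp_all
    obtain c I J where c: "0 < c" "I \<longlonglongrightarrow> J" and IJ: "\<forall>n p. norm p = norm x \<longrightarrow> I n \<le> h n p * c"
      "\<forall>p. norm p = \<kappa> * norm x \<longrightarrow> \<phi> p * c \<le> J"
      using shell[OF ab] by blast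
    have I: "I n \<le> h n x * c" for n using IJ(1) by simp
    have J: "\<phi> (\<kappa> *\<^sub>R x) * c \<le> J" using IJ(2) \<kappa>(2) by simp
    have "l * c < \<phi> (\<kappa> *\<^sub>R x) * c" using \<kappa>(1) c(1) by simp
    with J have "l * c < J" by linarith
    then have "\<forall>\<^sub>F n in sequentially. l * c < I n" by (rule order_tendstoD[OF c(2)])
    then show "\<forall>\<^sub>F n in sequentially. l < h n x"
    proof (rule eventually_mono)
      fix n assume "l * c < I n"
      then have "l * c < h n x * c" using I[of n] by linarith
      then show "l < h n x" using c(1) by simp
    qed
  next
    fix l assume l: "\<phi> x < l"
    have "((\<lambda>\<kappa>. \<phi> (\<kappa> *\<^sub>R x)) \<longlongrightarrow> \<phi> x) (at_left 1)"
      using ray by (rule tendsto_mono[rotated]) (simp add: at_le)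
    then have "\<forall>\<^sub>F \<kappa> in at_left 1. \<phi> (\<kappa> *\<^sub>R x) < l" using l by (rule order_tendstoD)
    moreover have "\<forall>\<^sub>F \<kappa>::real in at_left 1. \<kappa> \<in> {0<..<1}" by (rule eventually_at_left_real) simp
    ultimately have "\<forall>\<^sub>F \<kappa> in at_left 1. \<phi> (\<kappa> *\<^sub>R x) < l \<and> \<kappa> \<in> {0<..<1}" by (rule eventually_conj)
    then obtain \<kappa> where \<kappa>: "\<phi> (\<kappa> *\<^sub>R x) < l" "0 < \<kappa>" "\<kappa> < 1"
      using eventually_happens'[of "at_left (1::real)"] by auto
    have ab: "0 \<le> \<kappa> * norm x" "\<kappa> * norm x < norm x" using x \<kappa>(2,3) by simp_all
    obtain c I J where c: "0 < c" "I \<longlonglongrightarrow> J" and IJ: "\<forall>n p. norm p = norm x \<longrightarrow> h n p * c \<le> I n"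
      "\<forall>p. norm p = \<kappa> * norm x \<longrightarrow> J \<le> \<phi> p * c"
      using shell[OF ab] by blast
    have I: "h n x * c \<le> I n" for n using IJ(1) by simp
    have J: "J \<le> \<phi> (\<kappa> *\<^sub>R x) * c" using IJ(2) \<kappa>(2) by simp
    have "\<phi> (\<kappa> *\<^sub>R x) * c < l * c" using \<kappa>(1) c(1) by simp
    with J have "J < l * c" by linarith
    then have "\<forall>\<^sub>F n in sequentially. I n < l * c" by (rule order_tendstoD[OF c(2)])
    then show "\<forall>\<^sub>F n in sequentially. h n x < l"
    proof (rule eventually_mono)
      fix n assume "I n < l * c"
      then have "h n x * c < l * c" using I[of n] by linarith
      then show "h n x < l" using c(1) by simp
    qed
  qed
qed

section \<open>Uniform exponential moments\<close>

lemma integrable_exp_minus_norm: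
  assumes s: "0 < s"
  shows "integrable lborel (\<lambda>x :: 'b::euclidean_space. exp (- (s * norm x)))"
proof -
  define a where "a = s / DIM('b)"
  have a: "0 < a" using s by (simp add: a_def)
  have one: "(\<integral>\<^sup>+x. ennreal (exp (- (a * \<bar>x\<bar>))) \<partial>lborel) < \<infinity>"
  proof -
    have "has_bochner_integral lborel (\<lambda>x::real. exp (- \<bar>x\<bar>)) (2 *\<^sub>R fact 0)"
    proof (rule has_bochner_integral_even_function)
      have "(\<lambda>x::real. indicator {0..} x *\<^sub>R exp (- \<bar>x\<bar>)) = (\<lambda>x. x ^ 0 * exp (- x) * indicator {0..} x)"
        by (auto simp: fun_eq_iff indicator_def)
      then show "has_bochner_integral lborel (\<lambda>x::real. indicator {0..} x *\<^sub>R exp (- \<bar>x\<bar>)) (fact 0)"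
        using has_bochner_integral_I0i_power_exp_m'[of 0] by simp
    qed simp
    then have "integrable lborel (\<lambda>x::real. exp (- \<bar>x\<bar>))" by (rule integrable.intros)
    then have "integrable lborel (\<lambda>x::real. exp (- \<bar>0 + a * x\<bar>))"
      using a by (intro lborel_integrable_real_affine) auto
    then show ?thesis using a by (auto simp: integrable_iff_bounded abs_mult)
  qed
  have bd: "exp (- (s * norm x)) \<le> (\<Prod>b\<in>Basis. exp (- (a * \<bar>x \<bullet> b\<bar>)))" for x :: 'b
  proof -
    have "(\<Sum>b\<in>Basis. \<bar>x \<bullet> b\<bar>) \<le> (\<Sum>b\<in>(Basis::'b set). norm x)"
      by (intro sum_mono Basis_le_norm)
    then have "a * (\<Sum>b\<in>Basis. \<bar>x \<bullet> b\<bar>) \<le> a * (DIM('b) * norm x)" using a by simp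
    also have "\<dots> = s * norm x" by (simp add: a_def)
    finally have "exp (- (s * norm x)) \<le> exp (\<Sum>b\<in>Basis. - (a * \<bar>x \<bullet> b\<bar>))"
      by (simp add: sum_negf sum_distrib_left)
    then show ?thesis by (simp add: exp_sum)
  qed
  have "(\<integral>\<^sup>+x. ennreal (exp (- (s * norm (x :: 'b)))) \<partial>lborel)
      \<le> (\<integral>\<^sup>+x. (\<Prod>b\<in>Basis. ennreal (exp (- (a * \<bar>x \<bullet> b\<bar>)))) \<partial>(lborel :: 'b measure))"
    using bd by (intro nn_integral_mono) (simp add: prod_ennreal ennreal_leI)
  also have "\<dots> = (\<Prod>b\<in>(Basis::'b set). \<integral>\<^sup>+x. ennreal (exp (- (a * \<bar>x\<bar>))) \<partial>lborel)"
    by (rule nn_integral_lborel_prod) auto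
  also have "\<dots> < \<infinity>" using one by (simp add: power_less_top_ennreal)
  finally show ?thesis by (intro integrableI_nonneg) auto
qed

lemma (in prob_space) integrable_inner_power2_of_bounded:
  fixes X :: "'a \<Rightarrow> 'b::euclidean_space"
  assumes [measurable]: "X \<in> borel_measurable M" and bounded: "AE \<omega> in M. norm (X \<omega>) \<le> R"
  shows "integrable M (\<lambda>\<omega>. (t \<bullet> X \<omega>)\<^sup>2)"
proof (rule integrable_const_bound)
  show "AE \<omega> in M. norm ((t \<bullet> X \<omega>)\<^sup>2) \<le> (norm t * R)\<^sup>2"
    using bounded
  proof eventually_elim
    case (elim \<omega>)
    then have "\<bar>t \<bullet> X \<omega>\<bar> \<le> norm t * R"
      using Cauchy_Schwarz_ineq2[of t "X \<omega>"] mult_left_mono[OF elim, of "norm t"] by simp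
    then have "\<bar>t \<bullet> X \<omega>\<bar>\<^sup>2 \<le> (norm t * R)\<^sup>2" by (intro power_mono) auto
    then show ?case by simp
  qed
qed simp

lemma (in prob_space) exp_moment_normalized_sum_le:
  fixes Y :: "nat \<Rightarrow> 'a \<Rightarrow> real"
  assumes indep: "indep_vars (\<lambda>_. borel) Y UNIV"
    and bounded: "\<And>i. AE \<omega> in M. \<bar>Y i \<omega>\<bar> \<le> R" and mean: "\<And>i. expectation (Y i) = 0"
    and l: "0 < l" and n: "0 < n"
  shows "(\<integral>\<^sup>+\<omega>. ennreal (exp (l * ((1 / sqrt (real n)) * (\<Sum>i<n. Y i \<omega>)))) \<partial>M) \<le> ennreal (exp (l\<^sup>2 * R\<^sup>2 / 2))"
proof -
  have [measurable]: "Y i \<in> borel_measurable M" for i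
    using indep unfolding indep_vars_def2 by simp
  define m where "m = l / sqrt (real n)"
  have m: "0 < m" using l n by (simp add: m_def)
  have "(\<integral>\<^sup>+\<omega>. ennreal (exp (l * ((1 / sqrt (real n)) * (\<Sum>i<n. Y i \<omega>)))) \<partial>M)
      = (\<integral>\<^sup>+\<omega>. (\<Prod>i<n. ennreal (exp (m * Y i \<omega>))) \<partial>M)"
    by (intro nn_integral_cong) (simp add: prod_ennreal exp_sum m_def sum_distrib_left)
  also have "\<dots> = (\<Prod>i<n. \<integral>\<^sup>+\<omega>. ennreal (exp (m * Y i \<omega>)) \<partial>M)"
    by (intro indep_vars_nn_integral indep_vars_compose2[OF indep_vars_subset[OF indep]]) auto
  also have "\<dots> \<le> (\<Prod>i<n. ennreal (exp (m\<^sup>2 * (R - (- R))\<^sup>2 / 8)))"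
  proof (intro prod_mono_ennreal)
    fix i
    interpret interval_bounded_random_variable M "Y i" "- R" R
    proof unfold_locales
      show "AE \<omega> in M. Y i \<omega> \<in> {- R..R}"
        using bounded[of i] by eventually_elim auto
    qed simp
    show "(\<integral>\<^sup>+\<omega>. ennreal (exp (m * Y i \<omega>)) \<partial>M) \<le> ennreal (exp (m\<^sup>2 * (R - (- R))\<^sup>2 / 8))"
      by (rule Hoeffdings_lemma_nn_integral_0[OF m mean])
  qed
  also have "\<dots> = ennreal (exp (real n * (m\<^sup>2 * (R - (- R))\<^sup>2 / 8)))"
    by (simp only: prod_constant card_lessThan ennreal_power exp_ge_zero exp_of_nat_mult)
  also have "real n * (m\<^sup>2 * (R - (- R))\<^sup>2 / 8) = l\<^sup>2 * R\<^sup>2 / 2"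
    using n by (simp add: m_def power_divide power2_eq_square)
  finally show ?thesis .
qed

text \<open>
  Some coordinate satisfies \<open>norm z \<le> DIM('b) * \<bar>z \<bullet> b\<bar>\<close>, so \<open>exp (norm z)\<close> is at most the sum of the
  exponentials of \<open>\<plusminus> DIM('b) * (z \<bullet> b)\<close> over the basis. By Hoeffding's lemma for the coordinates,
  the expectation of each term is bounded uniformly in \<open>n\<close>.
\<close>

lemma (in prob_space) exp_norm_moment_normalized_sum_le:
  fixes X :: "nat \<Rightarrow> 'a \<Rightarrow> 'b::euclidean_space"
  assumes indep: "indep_vars (\<lambda>_. borel) X UNIV"
    and bounded: "\<And>i. AE \<omega> in M. norm (X i \<omega>) \<le> R"
    and mean: "\<And>i t. expectation (\<lambda>\<omega>. t \<bullet> X i \<omega>) = 0" and n: "0 < n"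
  shows "(\<integral>\<^sup>+\<omega>. ennreal (exp (norm ((1 / sqrt (real n)) *\<^sub>R (\<Sum>i<n. X i \<omega>)))) \<partial>M)
    \<le> ennreal (2 * DIM('b) * exp ((real DIM('b))\<^sup>2 * R\<^sup>2 / 2))"
proof -
  let ?d = "real DIM('b)" and ?B = "Basis :: 'b set"
  define Z where "Z \<omega> = (1 / sqrt (real n)) *\<^sub>R (\<Sum>i<n. X i \<omega>)" for \<omega>
  have [measurable]: "X i \<in> borel_measurable M" for i
    using indep unfolding indep_vars_def2 by simp
  have [measurable]: "Z \<in> borel_measurable M" unfolding Z_def[abs_def] by measurable
  have pointwise: "exp (norm z) \<le> (\<Sum>b\<in>?B. exp (?d * (b \<bullet> z)) + exp (?d * (- b \<bullet> z)))" for z :: 'b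
  proof -
    have "Max ((\<lambda>c. \<bar>z \<bullet> c\<bar>) ` ?B) \<in> (\<lambda>c. \<bar>z \<bullet> c\<bar>) ` ?B" by (intro Max_in) auto
    then obtain b where b: "b \<in> ?B" and bmax: "Max ((\<lambda>c. \<bar>z \<bullet> c\<bar>) ` ?B) = \<bar>z \<bullet> b\<bar>" by blast
    have max: "\<bar>z \<bullet> c\<bar> \<le> \<bar>z \<bullet> b\<bar>" if "c \<in> ?B" for c
      unfolding bmax[symmetric] using that by (intro Max_ge) auto
    have "norm z \<le> (\<Sum>c\<in>?B. \<bar>z \<bullet> c\<bar>)" by (rule norm_le_l1)
    also have "\<dots> \<le> (\<Sum>c\<in>?B. \<bar>z \<bullet> b\<bar>)" by (intro sum_mono max)
    finally have "exp (norm z) \<le> exp (?d * \<bar>z \<bullet> b\<bar>)" by simp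
    also have "\<dots> \<le> exp (?d * (b \<bullet> z)) + exp (?d * (- b \<bullet> z))"
      by (cases "0 \<le> z \<bullet> b") (simp_all add: inner_commute)
    also have "\<dots> \<le> (\<Sum>b\<in>?B. exp (?d * (b \<bullet> z)) + exp (?d * (- b \<bullet> z)))"
      using b by (intro member_le_sum) (auto intro: add_nonneg_nonneg)
    finally show ?thesis .
  qed
  have dir: "(\<integral>\<^sup>+\<omega>. ennreal (exp (?d * (t \<bullet> Z \<omega>))) \<partial>M) \<le> ennreal (exp (?d\<^sup>2 * R\<^sup>2 / 2))"
    if t: "norm t = 1" for t
  proof -
    have "AE \<omega> in M. \<bar>t \<bullet> X i \<omega>\<bar> \<le> R" for i
      using bounded[of i]
    proof eventually_elim
      case (elim \<omega>)
      then show ?case using Cauchy_Schwarz_ineq2[of t "X i \<omega>"] t by simp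
    qed
    then show ?thesis
      using exp_moment_normalized_sum_le[of "\<lambda>i \<omega>. t \<bullet> X i \<omega>" R ?d n] mean n
        indep_vars_compose2[OF indep, of "\<lambda>_ x. t \<bullet> x" "\<lambda>_. borel"]
      by (simp add: Z_def inner_sum_right)
  qed
  have "(\<integral>\<^sup>+\<omega>. ennreal (exp (norm (Z \<omega>))) \<partial>M)
      \<le> (\<integral>\<^sup>+\<omega>. (\<Sum>b\<in>?B. ennreal (exp (?d * (b \<bullet> Z \<omega>))) + ennreal (exp (?d * (- b \<bullet> Z \<omega>)))) \<partial>M)"
    using pointwise by (intro nn_integral_mono) (simp add: sum_nonneg ennreal_leI flip: ennreal_plus)
  also have "\<dots> = (\<Sum>b\<in>?B. (\<integral>\<^sup>+\<omega>. ennreal (exp (?d * (b \<bullet> Z \<omega>))) \<partial>M)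
      + (\<integral>\<^sup>+\<omega>. ennreal (exp (?d * (- b \<bullet> Z \<omega>))) \<partial>M))"
    by (subst nn_integral_sum) (simp_all add: nn_integral_add)
  also have "\<dots> \<le> (\<Sum>b\<in>?B. ennreal (exp (?d\<^sup>2 * R\<^sup>2 / 2)) + ennreal (exp (?d\<^sup>2 * R\<^sup>2 / 2)))"
    by (intro sum_mono add_mono dir) auto
  also have "\<dots> = ennreal (\<Sum>b\<in>?B. exp (?d\<^sup>2 * R\<^sup>2 / 2) + exp (?d\<^sup>2 * R\<^sup>2 / 2))"
    by (simp only: ennreal_plus[symmetric] exp_ge_zero sum_ennreal add_nonneg_nonneg)
  also have "(\<Sum>b\<in>?B. exp (?d\<^sup>2 * R\<^sup>2 / 2) + exp (?d\<^sup>2 * R\<^sup>2 / 2)) = 2 * DIM('b) * exp (?d\<^sup>2 * R\<^sup>2 / 2)"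
    by simp
  finally show ?thesis unfolding Z_def .
qed

section \<open>Convergence of integrals of small powers\<close>

text \<open>
  Truncation at height \<open>K\<close> changes a power with exponent below one by at most a multiple of \<open>y\<close> that
  vanishes as \<open>K\<close> grows. This turns an \<open>L\<^sup>1\<close> bound into uniform integrability of \<open>r\<close>-th powers.
\<close>

lemma powr_truncation_error:
  fixes y K r :: real
  assumes "0 \<le> y" "0 < K" "0 < r" "r < 1"
  shows "min y K powr r \<le> y powr r" and "y powr r - min y K powr r \<le> K powr (r - 1) * y"
proof -
  show "min y K powr r \<le> y powr r" using assms by (intro powr_mono2) auto
  show "y powr r - min y K powr r \<le> K powr (r - 1) * y"
  proof (cases "y \<le> K")
    case False
    then have "y powr r = y powr (r - 1) * y" using assms by (simp add: powr_diff)
    also have "\<dots> \<le> K powr (r - 1) * y" using False assms by (intro mult_right_mono powr_mono2') auto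
    finally show ?thesis using powr_ge_zero[of "min y K" r] by linarith
  qed (use assms in auto)
qed

lemma powr_le_one_plus:
  fixes y r :: real
  assumes "0 \<le> y" "0 < r" "r < 1"
  shows "y powr r \<le> 1 + y"
proof (cases "y \<le> 1")
  case True
  then show ?thesis using powr_mono2[of r y 1] assms by simp
next
  case False
  then show ?thesis using powr_mono[of r 1 y] assms by simp
qed

text \<open>
  Truncate the functions at height \<open>K\<close>. The truncated integrals converge by bounded convergence, and by
  \<open>powr_truncation_error\<close> the error of truncation is at most \<open>K powr (r - 1) * C\<close>, uniformly in \<open>n\<close>. Fatou's
  lemma supplies the \<open>L\<^sup>1\<close> bound for the limit function.
\<close>

lemma (in finite_measure) integral_powr_tendsto:
  fixes g :: "nat \<Rightarrow> 'a \<Rightarrow> real"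
  assumes r: "0 < r" "r < 1"
    and [measurable]: "\<And>n. g n \<in> borel_measurable M" "G \<in> borel_measurable M"
    and g0: "\<And>n x. 0 \<le> g n x" and G0: "\<And>x. 0 \<le> G x"
    and lim: "AE x in M. (\<lambda>n. g n x) \<longlonglongrightarrow> G x"
    and bound: "\<And>n. (\<integral>\<^sup>+x. ennreal (g n x) \<partial>M) \<le> ennreal C"
  shows "integrable M (\<lambda>x. g n x powr r)" and "integrable M (\<lambda>x. G x powr r)"
    and "(\<lambda>n. \<integral>x. g n x powr r \<partial>M) \<longlonglongrightarrow> (\<integral>x. G x powr r \<partial>M)"
proof -
  \<comment> \<open>For negative \<open>C\<close> the bound \<open>ennreal C\<close> is \<open>0\<close>.\<close>
  define D where "D = max C 0"
  have "(\<integral>\<^sup>+x. ennreal (G x) \<partial>M) = (\<integral>\<^sup>+x. liminf (\<lambda>n. ennreal (g n x)) \<partial>M)"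
    using lim by (intro nn_integral_cong_AE, eventually_elim)
      (metis lim_imp_Liminf sequentially_bot tendsto_ennrealI)
  also have "\<dots> \<le> liminf (\<lambda>n. \<integral>\<^sup>+x. ennreal (g n x) \<partial>M)" by (rule nn_integral_liminf) measurable
  also have "\<dots> \<le> liminf (\<lambda>n. ennreal C)"
    by (intro Liminf_mono always_eventually allI bound)
  also have "\<dots> = ennreal C" by (simp add: Liminf_const)
  finally have Gbound: "(\<integral>\<^sup>+x. ennreal (G x) \<partial>M) \<le> ennreal C" .
  have err: "integrable M k \<and> integrable M (\<lambda>x. k x powr r)
      \<and> (0 < K \<longrightarrow> \<bar>(\<integral>x. k x powr r \<partial>M) - (\<integral>x. min (k x) K powr r \<partial>M)\<bar> \<le> K powr (r - 1) * D)"
    if [measurable]: "k \<in> borel_measurable M" and k0: "\<And>x. 0 \<le> k x"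
      and kC: "(\<integral>\<^sup>+x. ennreal (k x) \<partial>M) \<le> ennreal C" for k K
  proof -
    have ki: "integrable M k"
      using kC le_less_trans[OF kC] k0 by (intro integrableI_nonneg) (auto simp: less_top)
    have "ennreal (\<integral>x. k x \<partial>M) \<le> ennreal C"
      using kC nn_integral_eq_integral[OF ki] k0 by simp
    then have kD: "(\<integral>x. k x \<partial>M) \<le> D"
      by (metis D_def ennreal_le_iff2 max.coboundedI1 max.coboundedI2)
    have "integrable M (\<lambda>x. 1 + k x)" using ki by simp
    then have kr: "integrable M (\<lambda>x. k x powr r)"
      by (rule Bochner_Integration.integrable_bound) (auto simp: k0 powr_le_one_plus[OF k0 r])
    have "\<bar>(\<integral>x. k x powr r \<partial>M) - (\<integral>x. min (k x) K powr r \<partial>M)\<bar> \<le> K powr (r - 1) * D" if K: "0 < K"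
    proof -
      have mr: "integrable M (\<lambda>x. min (k x) K powr r)"
        using kr by (rule Bochner_Integration.integrable_bound) (auto simp: powr_truncation_error[OF k0 K r])
      have "(\<integral>x. k x powr r \<partial>M) - (\<integral>x. min (k x) K powr r \<partial>M) = (\<integral>x. k x powr r - min (k x) K powr r \<partial>M)"
        using kr mr by simp
      moreover have "0 \<le> (\<integral>x. k x powr r - min (k x) K powr r \<partial>M)"
        by (intro Bochner_Integration.integral_nonneg) (simp add: powr_truncation_error[OF k0 K r])
      moreover have "(\<integral>x. k x powr r - min (k x) K powr r \<partial>M) \<le> (\<integral>x. K powr (r - 1) * k x \<partial>M)"
        using kr mr ki by (intro integral_mono) (auto simp: powr_truncation_error[OF k0 K r])
      moreover have "(\<integral>x. K powr (r - 1) * k x \<partial>M) \<le> K powr (r - 1) * D"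
        using kD by (simp add: mult_left_mono)
      ultimately show ?thesis by simp
    qed
    then show ?thesis using ki kr by blast
  qed
  show "integrable M (\<lambda>x. g n x powr r)" "integrable M (\<lambda>x. G x powr r)"
    using err g0 G0 bound Gbound by auto
  have trunc: "(\<lambda>n. \<integral>x. min (g n x) K powr r \<partial>M) \<longlonglongrightarrow> (\<integral>x. min (G x) K powr r \<partial>M)" if K: "0 < K" for K
  proof (rule integral_dominated_convergence[where w = "\<lambda>_. K powr r"])
    show "AE x in M. (\<lambda>n. min (g n x) K powr r) \<longlonglongrightarrow> min (G x) K powr r"
      using lim
    proof eventually_elim
      case (elim x)
      then show ?case using r g0 K by (intro tendsto_intros) auto
    qed
    show "AE x in M. norm (min (g n x) K powr r) \<le> K powr r" for n
      using r g0 K by (auto intro!: AE_I2 powr_mono2)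
  qed auto
  show "(\<lambda>n. \<integral>x. g n x powr r \<partial>M) \<longlonglongrightarrow> (\<integral>x. G x powr r \<partial>M)"
  proof (rule LIMSEQ_I)
    fix e :: real assume e: "0 < e"
    have "((\<lambda>K. K powr (r - 1) * D) \<longlongrightarrow> 0 * D) at_top"
      using r by (intro tendsto_intros tendsto_neg_powr filterlim_ident) auto
    then have "\<forall>\<^sub>F K in at_top. K powr (r - 1) * D < e / 3" using e by (intro order_tendstoD) auto
    then have "\<forall>\<^sub>F K in at_top. K powr (r - 1) * D < e / 3 \<and> 0 < K"
      using eventually_gt_at_top by (rule eventually_conj)
    then obtain K where K: "K powr (r - 1) * D < e / 3" "0 < K"
      using eventually_happens trivial_limit_at_top_linorder by blast
    obtain n0 where n0: "\<And>n. n0 \<le> n \<Longrightarrow>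
        norm ((\<integral>x. min (g n x) K powr r \<partial>M) - (\<integral>x. min (G x) K powr r \<partial>M)) < e / 3"
      using LIMSEQ_D[OF trunc[OF K(2)], of "e / 3"] e by auto
    show "\<exists>n0. \<forall>n\<ge>n0. norm ((\<integral>x. g n x powr r \<partial>M) - (\<integral>x. G x powr r \<partial>M)) < e"
    proof (intro exI allI impI)
      fix n assume n: "n0 \<le> n"
      have "\<bar>(\<integral>x. g n x powr r \<partial>M) - (\<integral>x. min (g n x) K powr r \<partial>M)\<bar> \<le> K powr (r - 1) * D"
        "\<bar>(\<integral>x. G x powr r \<partial>M) - (\<integral>x. min (G x) K powr r \<partial>M)\<bar> \<le> K powr (r - 1) * D"
        using err K(2) g0 G0 bound Gbound by auto
      then show "norm ((\<integral>x. g n x powr r \<partial>M) - (\<integral>x. G x powr r \<partial>M)) < e"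
        using n0[OF n] K(1) unfolding real_norm_def by linarith
    qed
  qed
qed

section \<open>Convergence of the entropies\<close>

text \<open>
  Lebesgue measure is replaced by the finite measure with density \<open>V x = exp (- (s * norm x))\<close>. With
  \<open>W x = exp ((1 + s) * norm x)\<close> the integral of \<open>h n * W\<close> with respect to it is the exponential moment
  of \<open>norm (Y n)\<close>. The choice \<open>s = r / (1 - r)\<close> makes \<open>V * W powr r = 1\<close>, so that the integral of the
  \<open>r\<close>-th power of \<open>h n * W\<close> is the integral of \<open>h n powr r\<close> with respect to Lebesgue measure.
\<close>

lemma density_powr_tendsto:
  fixes Y :: "nat \<Rightarrow> 'c \<Rightarrow> 'b::euclidean_space"
    and h :: "nat \<Rightarrow> 'b \<Rightarrow> real" and \<phi> :: "'b \<Rightarrow> real"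
  assumes r: "0 < r" "r < 1"
    and Y: "\<And>n. distributed M lborel (Y n) (\<lambda>x. ennreal (h n x))"
    and h0: "\<And>n x. 0 \<le> h n x" and \<phi>0: "\<And>x. 0 \<le> \<phi> x"
    and \<phi>m [measurable]: "\<phi> \<in> borel_measurable borel"
    and lim: "AE x in lborel. (\<lambda>n. h n x) \<longlonglongrightarrow> \<phi> x"
    and bound: "\<And>n. (\<integral>\<^sup>+\<omega>. ennreal (exp (norm (Y n \<omega>))) \<partial>M) \<le> ennreal C"
  shows "integrable lborel (\<lambda>x. h n x powr r)" and "integrable lborel (\<lambda>x. \<phi> x powr r)"
    and "(\<lambda>n. \<integral>x. h n x powr r \<partial>lborel) \<longlonglongrightarrow> (\<integral>x. \<phi> x powr r \<partial>lborel)"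
proof -
  define s where "s = r / (1 - r)"
  have s: "0 < s" "r * (1 + s) = s" using r by (auto simp: s_def field_simps)
  define V where "V x = exp (- (s * norm x))" for x :: 'b
  define W where "W x = exp ((1 + s) * norm x)" for x :: 'b
  have [measurable]: "V \<in> borel_measurable borel" "W \<in> borel_measurable borel"
    unfolding V_def[abs_def] W_def[abs_def] by measurable
  have hm [measurable]: "h n \<in> borel_measurable borel" for n
    using Y[of n] h0 by (auto simp: distributed_def intro!: borel_measurable_enn_nonneg)
  let ?\<nu> = "density lborel (\<lambda>x. ennreal (V x))"
  have V0: "0 \<le> V x" for x by (simp add: V_def)
  have cancel: "V x * (k * W x) powr r = k powr r" if "0 \<le> k" for k x
  proof -
    have "W x powr r = exp (s * norm x)" using s(2) by (simp add: W_def powr_def mult.assoc[symmetric])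
    then have "V x * W x powr r = 1" by (simp add: V_def exp_add[symmetric])
    then show ?thesis using that by (simp add: powr_mult W_def mult.left_commute)
  qed
  interpret finite_measure ?\<nu>
  proof
    have "(\<integral>\<^sup>+x. ennreal (V x) \<partial>lborel) < \<infinity>"
      using integrable_exp_minus_norm[OF s(1), where 'b = 'b] by (simp add: V_def integrable_iff_bounded)
    then show "emeasure ?\<nu> (space ?\<nu>) \<noteq> \<infinity>" by (simp add: emeasure_density)
  qed
  have m0: "0 \<le> h n x * W x" "0 \<le> \<phi> x * W x" for n x using h0 \<phi>0 by (simp_all add: W_def)
  have ae: "AE x in ?\<nu>. (\<lambda>n. h n x * W x) \<longlonglongrightarrow> \<phi> x * W x"
    using lim by (subst AE_density) (auto elim!: eventually_mono intro!: tendsto_intros)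
  have "(\<integral>\<^sup>+x. ennreal (h n x * W x) \<partial>?\<nu>) \<le> ennreal C" for n
  proof -
    have "(\<integral>\<^sup>+x. ennreal (h n x * W x) \<partial>?\<nu>) = (\<integral>\<^sup>+x. ennreal (h n x) * ennreal (exp (norm x)) \<partial>lborel)"
      using h0 by (simp add: nn_integral_density V_def W_def ennreal_mult[symmetric] mult.left_commute
          exp_add[symmetric] algebra_simps)
    also have "\<dots> = (\<integral>\<^sup>+\<omega>. ennreal (exp (norm (Y n \<omega>))) \<partial>M)"
      by (rule distributed_nn_integral[OF Y]) simp
    finally show ?thesis using bound[of n] by simp
  qed
  note conv = integral_powr_tendsto[OF r _ _ m0 ae this]
  show "integrable lborel (\<lambda>x. h n x powr r)"
    using conv(1)[of n] by (simp add: integrable_density V0 cancel h0)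
  show "integrable lborel (\<lambda>x. \<phi> x powr r)"
    using conv(2) by (simp add: integrable_density V0 cancel \<phi>0)
  show "(\<lambda>n. \<integral>x. h n x powr r \<partial>lborel) \<longlonglongrightarrow> (\<integral>x. \<phi> x powr r \<partial>lborel)"
    using conv(3) by (simp add: integral_density V0 cancel \<phi>0 h0)
qed

lemma renyi_entropy_eq_ln:
  fixes f :: "'b::euclidean_space \<Rightarrow> real"
  assumes "distributed M lborel X (\<lambda>x. ennreal (f x))" "\<And>x. 0 \<le> f x"
    and "integrable lborel (\<lambda>x. f x powr r)" and "0 < (\<integral>x. f x powr r \<partial>lborel)"
  shows "renyi_entropy r M X = ereal (1 / (1 - r) * ln (\<integral>x. f x powr r \<partial>lborel))"
  using assms(3,4)
  by (simp add: renyi_entropy_distributed[OF assms(1,2)] nn_integral_eq_integral ln_ereal_def)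

lemma renyi_entropy_tendsto:
  fixes Z :: "'a \<Rightarrow> 'b::euclidean_space" and Y :: "nat \<Rightarrow> 'c \<Rightarrow> 'b"
    and h :: "nat \<Rightarrow> 'b \<Rightarrow> real" and \<phi> :: "'b \<Rightarrow> real"
  assumes r: "0 < r" "r < 1" and N: "prob_space N"
    and Y: "\<And>n. distributed M lborel (Y n) (\<lambda>x. ennreal (h n x))"
    and Z: "distributed N lborel Z (\<lambda>x. ennreal (\<phi> x))"
    and h0: "\<And>n x. 0 \<le> h n x" and \<phi>0: "\<And>x. 0 \<le> \<phi> x"
    and lim: "AE x in lborel. (\<lambda>n. h n x) \<longlonglongrightarrow> \<phi> x"
    and bound: "\<And>n. (\<integral>\<^sup>+\<omega>. ennreal (exp (norm (Y n \<omega>))) \<partial>M) \<le> ennreal C"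
  shows "(\<lambda>n. renyi_entropy r M (Y n)) \<longlonglongrightarrow> renyi_entropy r N Z"
proof -
  have \<phi>m [measurable]: "\<phi> \<in> borel_measurable borel"
    using Z \<phi>0 by (auto simp: distributed_def intro!: borel_measurable_enn_nonneg)
  note conv = density_powr_tendsto[OF r Y h0 \<phi>0 \<phi>m lim bound]
  let ?I = "\<lambda>n. \<integral>x. h n x powr r \<partial>lborel" and ?J = "\<integral>x. \<phi> x powr r \<partial>lborel"
  have "?J \<noteq> 0"
  proof
    assume "?J = 0"
    then have "AE x in lborel. \<phi> x powr r = 0"
      using integral_nonneg_eq_0_iff_AE[OF conv(2)] by simp
    then have "(\<integral>\<^sup>+x. ennreal (\<phi> x) \<partial>lborel) = (\<integral>\<^sup>+x. 0 \<partial>(lborel :: 'b measure))"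
      by (intro nn_integral_cong_AE, eventually_elim) simp
    then show False using prob_space.distributed_real_nn_integral[OF N Z] by simp
  qed
  then have J: "0 < ?J" by (simp add: less_le Bochner_Integration.integral_nonneg)
  have "(\<lambda>n. ereal (1 / (1 - r) * ln (?I n))) \<longlonglongrightarrow> ereal (1 / (1 - r) * ln ?J)"
    using J by (intro tendsto_intros conv(3)) simp
  moreover have "\<forall>\<^sub>F n in sequentially. 0 < ?I n" using J by (rule order_tendstoD[OF conv(3)])
  then have "\<forall>\<^sub>F n in sequentially. ereal (1 / (1 - r) * ln (?I n)) = renyi_entropy r M (Y n)"
    by eventually_elim (rule renyi_entropy_eq_ln[OF Y h0 conv(1), symmetric])
  ultimately show ?thesis
    unfolding renyi_entropy_eq_ln[OF Z \<phi>0 conv(2) J] by (rule Lim_transform_eventually)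
qed

lemma iso_gauss_eq:
  fixes x :: "'b::euclidean_space"
  shows "iso_gauss s x = exp (- (norm x)\<^sup>2 / (2 * s\<^sup>2)) / sqrt (2 * pi * s\<^sup>2) ^ DIM('b)"
proof -
  have n: "(norm x)\<^sup>2 = (\<Sum>b\<in>Basis. (x \<bullet> b)\<^sup>2)"
    unfolding power2_norm_eq_inner by (subst euclidean_inner) (simp add: power2_eq_square)
  have "- (norm x)\<^sup>2 / (2 * s\<^sup>2) = (\<Sum>b\<in>Basis. - (x \<bullet> b)\<^sup>2 / (2 * s\<^sup>2))"
    unfolding n by (simp add: sum_negf sum_divide_distrib)
  then have "exp (- (norm x)\<^sup>2 / (2 * s\<^sup>2)) = (\<Prod>b\<in>(Basis::'b set). exp (- (x \<bullet> b)\<^sup>2 / (2 * s\<^sup>2)))"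
    by (simp only: exp_sum finite_Basis)
  then show ?thesis
    unfolding iso_gauss_def normal_density_def by (simp add: prod.distrib prod_dividef)
qed

lemma radially_antimono_iso_gauss: "radially_antimono (iso_gauss s)"
  unfolding radially_antimono_def iso_gauss_eq
  by (auto intro!: divide_right_mono power_mono)

lemma isCont_iso_gauss: "0 < s \<Longrightarrow> isCont (iso_gauss s) x"
  unfolding iso_gauss_eq[abs_def] by (intro continuous_intros) auto

theorem renyi_entropy_clt_radially_antimono:
  fixes X :: "nat \<Rightarrow> 'a \<Rightarrow> 'b::euclidean_space" and f :: "'b \<Rightarrow> real" and Z :: "'c \<Rightarrow> 'b"
  assumes r: "0 < r" "r < 1"
    and M: "prob_space M" and indep: "prob_space.indep_vars M (\<lambda>_. borel) X UNIV"
    and X: "\<And>n. distributed M lborel (X n) (\<lambda>x. ennreal (f x))"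
    and f0: "\<And>x. 0 \<le> f x" and f: "radially_antimono f"
    and bounded: "\<And>n. AE \<omega> in M. norm (X n \<omega>) \<le> R"
    and mean: "\<And>n t. (\<integral>\<omega>. t \<bullet> X n \<omega> \<partial>M) = 0"
    and var: "\<And>t. (\<integral>\<omega>. (t \<bullet> X 0 \<omega>)\<^sup>2 \<partial>M) = (s * norm t)\<^sup>2" and s: "0 < s"
    and N: "prob_space N" and Z: "distributed N lborel Z (\<lambda>x. ennreal (iso_gauss s x))"
  shows "(\<lambda>n. renyi_entropy r M (\<lambda>\<omega>. (1 / sqrt (real n)) *\<^sub>R (\<Sum>i<n. X i \<omega>))) \<longlonglongrightarrow> renyi_entropy r N Z"
proof -
  interpret M: prob_space M by fact
  \<comment> \<open>The index is shifted because the empty sum has no density.\<close>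
  define Y where "Y n \<omega> = (1 / sqrt (real (Suc n))) *\<^sub>R (\<Sum>i<Suc n. X i \<omega>)" for n \<omega>
  have [measurable]: "X n \<in> borel_measurable M" for n
    using indep unfolding M.indep_vars_def2 by simp
  have "\<forall>n. \<exists>h. distributed M lborel (Y n) (\<lambda>x. ennreal (h x)) \<and> (\<forall>x. 0 \<le> h x) \<and> radially_antimono h"
    using M.normalized_sum_has_radially_antimono_density[OF indep X f0 f] unfolding Y_def[abs_def] by blast
  then obtain h where h: "\<And>n. distributed M lborel (Y n) (\<lambda>x. ennreal (h n x))"
    and h0: "\<And>n x. 0 \<le> h n x" and hr: "\<And>n. radially_antimono (h n)"
    by metis
  have law: "distr M borel (X n) = distr M borel (X 0)" for n
  proof -
    have "distr M borel (X n) = density lborel (\<lambda>x. ennreal (f x))" for n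
      using X[of n] by (simp add: distributed_def cong: distr_cong)
    then show ?thesis by simp
  qed
  have sq: "integrable M (\<lambda>\<omega>. (t \<bullet> X 0 \<omega>)\<^sup>2)" for t
    by (rule M.integrable_inner_power2_of_bounded[OF _ bounded]) simp
  have "(\<lambda>n. \<integral>\<omega>. cos (t \<bullet> Y n \<omega>) \<partial>M) \<longlonglongrightarrow> exp (- (s * norm t)\<^sup>2 / 2)" for t
    using LIMSEQ_Suc[OF M.clt_cos[OF indep law mean sq var s, of t]] by (simp add: Y_def)
  moreover have "(\<integral>\<omega>. cos (t \<bullet> Z \<omega>) \<partial>N) = exp (- (s * norm t)\<^sup>2 / 2)" for t
    using iso_gauss_cos[OF s, of t] distributed_integral[OF Z, of "\<lambda>x. cos (t \<bullet> x)"]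
    by (simp add: iso_gauss_nonneg)
  ultimately have cos: "(\<lambda>n. \<integral>\<omega>. cos (t \<bullet> Y n \<omega>) \<partial>M) \<longlonglongrightarrow> (\<integral>\<omega>. cos (t \<bullet> Z \<omega>) \<partial>N)" for t
    by simp
  have "AE x in lborel. (\<lambda>n. h n x) \<longlonglongrightarrow> iso_gauss s x"
    using AE_lborel_singleton[of "0::'b"]
    by eventually_elim (rule radially_antimono_density_tendsto[OF M N h Z h0 hr iso_gauss_nonneg
          radially_antimono_iso_gauss isCont_iso_gauss[OF s] cos])
  moreover have "(\<integral>\<^sup>+\<omega>. ennreal (exp (norm (Y n \<omega>))) \<partial>M)
      \<le> ennreal (2 * DIM('b) * exp ((real DIM('b))\<^sup>2 * R\<^sup>2 / 2))" for n
    unfolding Y_def by (rule M.exp_norm_moment_normalized_sum_le[OF indep bounded mean]) simp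
  ultimately have "(\<lambda>n. renyi_entropy r M (Y n)) \<longlonglongrightarrow> renyi_entropy r N Z"
    by (rule renyi_entropy_tendsto[OF r N h Z h0 iso_gauss_nonneg])
  then show ?thesis unfolding Y_def[abs_def] by (rule LIMSEQ_imp_Suc)
qed

section \<open>Spherically symmetric unimodal densities\<close>

text \<open>
  A super-level set that contains \<open>y\<close> contains the whole sphere through \<open>y\<close>, and by convexity every
  chord of that sphere. A point \<open>x\<close> of smaller norm lies on the diameter through it.
\<close>

lemma unimodal_spherically_symmetric_imp_radially_antimono:
  fixes f :: "real ^ 'd \<Rightarrow> real"
  assumes sym: "spherically_symmetric f" and uni: "unimodal f"
  shows "radially_antimono f"
  unfolding radially_antimono_def
proof (intro allI impI)
  fix x y :: "real ^ 'd" assume le: "norm x \<le> norm y"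
  have eq: "f a = f b" if "norm a = norm b" for a b
  proof -
    obtain T where "orthogonal_transformation T" "T a = b"
      using orthogonal_transformation_exists[OF \<open>norm a = norm b\<close>] by blast
    then show ?thesis using sym unfolding spherically_symmetric_def by metis
  qed
  obtain c w where c: "0 \<le> c" "c \<le> 1" and x: "x = c *\<^sub>R w" and w: "norm w = norm y"
  proof (cases "x = 0")
    case True
    then show ?thesis using that[of 0 y] by simp
  next
    case False
    then have "0 < norm x" "0 < norm y" using le by auto
    then show ?thesis using that[of "norm x / norm y" "(norm y / norm x) *\<^sub>R x"] le by simp
  qed
  show "f y \<le> f x"
  proof (rule dense_le)
    fix t assume t: "t < f y"
    have "w \<in> {x. t < f x}" "- w \<in> {x. t < f x}"
      using t eq[of w y] eq[of "- w" y] w by simp_all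
    moreover have "convex {x. t < f x}" using uni by (simp add: unimodal_def)
    ultimately have "((1 + c) / 2) *\<^sub>R w + ((1 - c) / 2) *\<^sub>R (- w) \<in> {x. t < f x}"
      using c by (intro convexD) (auto simp: field_simps)
    moreover have "((1 + c) / 2) *\<^sub>R w + ((1 - c) / 2) *\<^sub>R (- w) = x"
    proof -
      have "((1 + c) / 2) *\<^sub>R w + ((1 - c) / 2) *\<^sub>R (- w) = ((1 + c) / 2 - (1 - c) / 2) *\<^sub>R w"
        unfolding scaleR_diff_left by simp
      also have "(1 + c) / 2 - (1 - c) / 2 = c" by (simp add: field_simps)
      finally show ?thesis by (simp add: x)
    qed
    ultimately show "t \<le> f x" by simp
  qed
qed

lemma (in prob_space) compactly_supported_imp_bounded:
  fixes f :: "'b::euclidean_space \<Rightarrow> real"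
  assumes "compactly_supported f"
  obtains R where "\<And>X. distributed M lborel X (\<lambda>x. ennreal (f x)) \<Longrightarrow> AE \<omega> in M. norm (X \<omega>) \<le> R"
proof -
  have "bounded (closure {x. f x \<noteq> 0})"
    using assms by (simp add: compactly_supported_def compact_imp_bounded)
  then obtain R where R: "\<And>x. f x \<noteq> 0 \<Longrightarrow> norm x \<le> R"
    using closure_subset[of "{x. f x \<noteq> 0}"] by (auto simp: bounded_iff)
  show thesis
  proof (rule that)
    fix X assume "distributed M lborel X (\<lambda>x. ennreal (f x))"
    then have d: "distr M lborel X = density lborel (\<lambda>x. ennreal (f x))"
      and m: "(\<lambda>x. ennreal (f x)) \<in> borel_measurable lborel" "X \<in> M \<rightarrow>\<^sub>M lborel"
      by (simp_all add: distributed_def)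
    have "AE x in distr M lborel X. norm x \<le> R"
      unfolding d by (subst AE_density[OF m(1)]) (auto intro!: AE_I2 R)
    then show "AE \<omega> in M. norm (X \<omega>) \<le> R" by (rule AE_distrD[OF m(2)])
  qed
qed

text \<open>
  The second moment in direction \<open>t\<close> depends on the norm of \<open>t\<close> only, since the law of \<open>X\<close> is invariant
  under orthogonal maps, which act transitively on spheres.
\<close>

lemma (in prob_space) isotropic_second_moment:
  fixes X :: "'a \<Rightarrow> real ^ 'd" and f :: "real ^ 'd \<Rightarrow> real"
  assumes sym: "spherically_symmetric f" and f0: "\<And>x. 0 \<le> f x"
    and X: "distributed M lborel X (\<lambda>x. ennreal (f x))"
  obtains s where "0 \<le> s" and "\<And>t. expectation (\<lambda>\<omega>. (t \<bullet> X \<omega>)\<^sup>2) = (s * norm t)\<^sup>2"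
proof -
  have fm [measurable]: "f \<in> borel_measurable borel" "X \<in> borel_measurable M"
    using X f0 by (auto simp: distributed_def intro!: borel_measurable_enn_nonneg)
  define V where "V t = expectation (\<lambda>\<omega>. (t \<bullet> X \<omega>)\<^sup>2)" for t
  have V: "V t = enn2real (\<integral>\<^sup>+x. ennreal (f x) * ennreal ((t \<bullet> x)\<^sup>2) \<partial>lborel)" for t
  proof -
    have "V t = enn2real (\<integral>\<^sup>+\<omega>. ennreal ((t \<bullet> X \<omega>)\<^sup>2) \<partial>M)"
      unfolding V_def by (rule integral_eq_nn_integral) simp_all
    then show ?thesis
      using distributed_nn_integral[OF X, of "\<lambda>x. ennreal ((t \<bullet> x)\<^sup>2)"] by simp
  qed
  have rot: "V a = V b" if ab: "norm a = norm b" for a b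
  proof -
    obtain T where T: "orthogonal_transformation T" "T a = b"
      using orthogonal_transformation_exists[OF ab] by blast
    have "(\<integral>\<^sup>+x. ennreal (f (T x)) * ennreal ((b \<bullet> T x)\<^sup>2) \<partial>lborel)
        = (\<integral>\<^sup>+x. ennreal (f x) * ennreal ((b \<bullet> x)\<^sup>2) \<partial>lborel)"
      using nn_integral_lborel_isometry[of T "\<lambda>x. ennreal (f x) * ennreal ((b \<bullet> x)\<^sup>2)"] T(1)
      by (simp add: orthogonal_transformation_linear orthogonal_transformation_norm)
    moreover have "f (T x) = f x" for x
      using sym T(1) unfolding spherically_symmetric_def by blast
    moreover have "b \<bullet> T x = a \<bullet> x" for x
      using T(1) unfolding orthogonal_transformation_def T(2)[symmetric] by blast
    ultimately show ?thesis by (simp add: V)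
  qed
  obtain e :: "real ^ 'd" where e: "norm e = 1" using vector_choose_size[of 1] by auto
  have V0: "0 \<le> V e" unfolding V_def by (intro Bochner_Integration.integral_nonneg) simp
  have "V t = (sqrt (V e) * norm t)\<^sup>2" for t
  proof -
    have "V t = V (norm t *\<^sub>R e)" by (rule rot) (simp add: e)
    also have "\<dots> = (norm t)\<^sup>2 * V e" by (simp add: V_def power_mult_distrib)
    also have "\<dots> = (sqrt (V e) * norm t)\<^sup>2" using V0 by (simp add: power_mult_distrib)
    finally show ?thesis .
  qed
  then have "expectation (\<lambda>\<omega>. (t \<bullet> X \<omega>)\<^sup>2) = (sqrt (V e) * norm t)\<^sup>2" for t
    unfolding V_def[of t, symmetric] .
  moreover have "0 \<le> sqrt (V e)" using V0 by simp
  ultimately show thesis using that by blast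
qed

text \<open>
  The quadratic form \<open>t \<mapsto> expectation (\<lambda>\<omega>. (t \<bullet> X \<omega>)\<^sup>2)\<close> determines the covariance matrix by
  polarization, applied to the sums and differences of coordinate vectors.
\<close>

lemma (in prob_space) isotropic_covariance_matrix:
  fixes X :: "'a \<Rightarrow> real ^ 'd"
  assumes [measurable]: "X \<in> borel_measurable M"
    and mean: "\<And>t. expectation (\<lambda>\<omega>. t \<bullet> X \<omega>) = 0"
    and int: "\<And>t. integrable M (\<lambda>\<omega>. (t \<bullet> X \<omega>)\<^sup>2)"
    and var: "\<And>t. expectation (\<lambda>\<omega>. (t \<bullet> X \<omega>)\<^sup>2) = (s * norm t)\<^sup>2"
  shows "covariance_matrix M X = mat (s\<^sup>2)"
proof -
  have "expectation (\<lambda>\<omega>. X \<omega> $ i * X \<omega> $ j) = (if i = j then s\<^sup>2 else 0)" for i j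
  proof -
    define a b :: "real ^ 'd" where "a = axis i 1 + axis j 1" and "b = axis i 1 - axis j 1"
    have "X \<omega> $ i * X \<omega> $ j = ((a \<bullet> X \<omega>)\<^sup>2 - (b \<bullet> X \<omega>)\<^sup>2) / 4" for \<omega>
      unfolding a_def b_def inner_add_left inner_diff_left inner_axis'
      by (simp add: power2_eq_square algebra_simps)
    then have "expectation (\<lambda>\<omega>. X \<omega> $ i * X \<omega> $ j) = expectation (\<lambda>\<omega>. ((a \<bullet> X \<omega>)\<^sup>2 - (b \<bullet> X \<omega>)\<^sup>2) / 4)"
      by (simp only:)
    also have "\<dots> = ((s * norm a)\<^sup>2 - (s * norm b)\<^sup>2) / 4"
      using int by (simp add: var)
    also have "\<dots> = s\<^sup>2 * ((norm a)\<^sup>2 - (norm b)\<^sup>2) / 4" by (simp add: power_mult_distrib algebra_simps)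
    also have "(norm a)\<^sup>2 - (norm b)\<^sup>2 = 4 * (axis i 1 \<bullet> (axis j 1 :: real ^ 'd))"
      unfolding a_def b_def power2_norm_eq_inner by (simp add: algebra_simps inner_commute)
    finally show ?thesis by (simp add: inner_axis_axis)
  qed
  moreover have "expectation (\<lambda>\<omega>. X \<omega> $ i) = 0" for i
    using mean[of "axis i 1"] by (simp add: inner_axis')
  ultimately show ?thesis
    by (simp add: covariance_matrix_def mat_def vec_eq_iff)
qed

lemma det_scalar_mat: "det (mat c :: real ^ 'd ^ 'd) = c ^ CARD('d)"
  by (subst det_diagonal) (auto simp: mat_def)

lemma gaussian_density_scalar_covariance:
  fixes x :: "real ^ 'd"
  assumes s: "0 < s"
  shows "gaussian_density 0 (mat (s\<^sup>2)) x = iso_gauss s x"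
proof -
  have scale: "mat c *v y = c *\<^sub>R y" for c and y :: "real ^ 'd"
    by (simp add: matrix_vector_mult_def mat_def vec_eq_iff mult_delta_left)
  have "invertible (mat (s\<^sup>2) :: real ^ 'd ^ 'd)" using s by (simp add: invertible_det_nz det_scalar_mat)
  then have "mat (s\<^sup>2) ** matrix_inv (mat (s\<^sup>2)) = (mat 1 :: real ^ 'd ^ 'd)" 
    unfolding invertible_def matrix_inv_def by (rule someI2_ex) blast
  then have "mat (s\<^sup>2) *v (matrix_inv (mat (s\<^sup>2)) *v x) = x"
    by (simp add: matrix_vector_mul_assoc)
  then have "(1 / s\<^sup>2) *\<^sub>R (s\<^sup>2 *\<^sub>R (matrix_inv (mat (s\<^sup>2)) *v x)) = (1 / s\<^sup>2) *\<^sub>R x" by (simp only: scale)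
  then have inv: "matrix_inv (mat (s\<^sup>2)) *v x = (1 / s\<^sup>2) *\<^sub>R x" using s by simp
  have "sqrt ((2 * pi) ^ CARD('d) * (s\<^sup>2) ^ CARD('d)) = sqrt (2 * pi * s\<^sup>2) ^ CARD('d)"
    by (simp add: real_sqrt_power[symmetric] power_mult_distrib)
  then show ?thesis
    by (simp add: gaussian_density_def iso_gauss_eq inv det_scalar_mat power2_norm_eq_inner)
qed

theorem theorem12:
  fixes M :: "'a measure" and N :: "'b measure"
    and X :: "nat \<Rightarrow> 'a \<Rightarrow> real ^ 'd" and Z :: "'b \<Rightarrow> real ^ 'd"
    and f :: "real ^ 'd \<Rightarrow> real" and r :: real
  assumes "0 < r" and "r < 1"
    and "prob_space M"
    and "prob_space.indep_vars M (\<lambda>_. borel) X UNIV"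
    and "\<And>n. distributed M lborel (X n) (\<lambda>x. ennreal (f x))"
    and "\<And>n i. integrable M (\<lambda>\<omega>. (X n \<omega> $ i)\<^sup>2)"
    and "\<And>n. prob_space.expectation M (X n) = 0"
    and "\<And>x. 0 \<le> f x"
    and "spherically_symmetric f" and "unimodal f" and "compactly_supported f"
    and "prob_space N"
    and "gaussian_vector N Z 0 (covariance_matrix M (X 0))"
  shows "(\<lambda>n. renyi_entropy r M (\<lambda>\<omega>. (1 / sqrt (real n)) *\<^sub>R (\<Sum>i<n. X i \<omega>)))
           \<longlonglongrightarrow> renyi_entropy r N Z"
proof -
  interpret M: prob_space M by fact
  note X = assms(5)
  have Xm [measurable]: "X n \<in> borel_measurable M" for n
    using X[of n] by (simp add: distributed_def)
  obtain R where bounded: "\<And>n. AE \<omega> in M. norm (X n \<omega>) \<le> R"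
    using M.compactly_supported_imp_bounded[OF assms(11)] X by metis
  have mean: "(\<integral>\<omega>. t \<bullet> X n \<omega> \<partial>M) = 0" for n t
  proof -
    have "integrable M (X n)" by (rule M.integrable_const_bound[OF bounded]) simp
    then show ?thesis using assms(7)[of n] by simp
  qed
  have int: "integrable M (\<lambda>\<omega>. (t \<bullet> X 0 \<omega>)\<^sup>2)" for t
    by (rule M.integrable_inner_power2_of_bounded[OF Xm bounded])
  obtain s where s: "0 \<le> s" and var: "\<And>t. (\<integral>\<omega>. (t \<bullet> X 0 \<omega>)\<^sup>2 \<partial>M) = (s * norm t)\<^sup>2"
    by (rule M.isotropic_second_moment[OF assms(9,8) X[of 0]]) blast
  have Z: "distributed N lborel Z (\<lambda>x. ennreal (gaussian_density 0 (mat (s\<^sup>2)) x))"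
    using assms(13) M.isotropic_covariance_matrix[OF Xm mean int var] by (simp add: gaussian_vector_def)
  \<comment> \<open>For a singular covariance matrix division by zero makes the Gaussian density identically \<open>0\<close>, and
    it would not integrate to \<open>1\<close>.\<close>
  have "s \<noteq> 0"
  proof
    assume "s = 0"
    then have "gaussian_density 0 (mat (s\<^sup>2)) x = 0" for x :: "real ^ 'd"
      unfolding gaussian_density_def det_scalar_mat by simp
    then show False using prob_space.distributed_real_nn_integral[OF assms(12) Z] by simp
  qed
  then have "0 < s" using s by simp
  then show ?thesis
    using renyi_entropy_clt_radially_antimono[OF assms(1-4) X assms(8)
        unimodal_spherically_symmetric_imp_radially_antimono[OF assms(9,10)] bounded mean var _ assms(12)] Z
    by (simp add: gaussian_density_scalar_covariance)
qed

end
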